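(* Let $\tau:\mathbb{Z}/2\mathbb{Z}\to\mathcal{C}_2$ be a faithful representation, where $\mathcal{C}_2=\{I,-I\}\subset O(\mathbb{R}^2)$ is the group generated by the half-turn about the origin, let $(H,\psi)$ be a finite $\mathbb{Z}/2\mathbb{Z}$-gain graph, and let $\tilde p:V(H)\to\mathbb{R}^2$ be $\mathcal{C}_2$-regular. Then $O_1(H,\psi,\tilde p)$ is row independent if and only if $(H,\psi)$ is $(2,3,2)$-gain-sparse.
   Context: A $\Gamma$-gain graph $(H,\psi)$ is a directed multigraph $H$ (loops and parallel edges allowed) with a map $\psi:E(H)\to\Gamma$; the orientation is only a reference, reversing an edge inverts its gain. Here $\Gamma=\mathbb{Z}/2\mathbb{Z}$. Gain-sparsity: a cycle (a loop is a cycle, two parallel edges form a cycle) is balanced if the product of its edge gains along the cycle (inverted for edges traversed backwards) is the identity. $F\subseteq E(H)$ is balanced if all cycles in $F$ are balanced. $V(F)$ is the set of endpoints of edges in $F$. $(H,\psi)$ is $(k,\ell,m)$-gain-sparse if $|F|\le k|V(F)|-\ell$ for every nonempty balanced $F\subseteq E(H)$ and $|F|\le k|V(F)|-m$ for every nonempty $F\subseteq E(H)$. Orbit rigidity matrix $O_1(H,\psi,\tilde p)$: the $|E(H)|\times 2|V(H)|$ matrix whose row for $\tilde e=(\tilde u,\tilde v)$ has $(\tilde p(\tilde u)-\tau(\psi(\tilde e))\tilde p(\tilde v))^\top$ in the two columns of $\tilde u$, $(-1)^{\psi(\tilde e)}(\tilde p(\tilde v)-\tau(\psi(\tilde e))^{-1}\tilde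 p(\tilde u))^\top$ in the two columns of $\tilde v$, and $0$ elsewhere; for a loop at $\tilde v$ the entries in the columns of $\tilde v$ are the sum of these two vectors. Row independent means the rows are linearly independent. Regularity: the covering graph $G$ of $(H,\psi)$ has vertex set $\Gamma\times V(H)$ (write $gv$ for $(g,v)$) and edges $\{g\tilde u,g\psi(\tilde e)\tilde v\}$ for $\tilde e=(\tilde u,\tilde v)\in E(H)$, $g\in\Gamma$. A map $\tilde p:V(H)\to\mathbb{R}^2$ determines $p:V(G)\to\mathbb{R}^2$ by $p(g\tilde v)=\tau(g)\tilde p(\tilde v)$. The rigidity matrix $R(G,p)$ has, for each edge $\{u,v\}$ of $G$, a row with $(p(u)-p(v))^\top$ in the columns of $u$, $(p(v)-p(u))^\top$ in the columns of $v$, and $0$ elsewhere (degenerate edges with both ends equal contribute a zero row). $\tilde p$ is $\mathcal{C}_2$-regular if $\operatorname{rank}R(G,p)$ is maximal among all maps $p$ arising in this way from maps $V(H)\to\mathbb{R}^2$. *)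

theory Defs
  imports "HOL-Analysis.Analysis" "HOL-Library.Z2" "Graph_Theory.Graph_Theory"
begin

instance bit :: finite
proof
  have "(UNIV :: bit set) = {0, 1}"
    by (auto intro: bit_not_zero_iff[THEN iffD1])
  then show "finite (UNIV :: bit set)"
    by (metis finite.emptyI finite.insertI)
qed

section \<open>Gain graphs and gain-sparsity\<close>

text \<open>
  A gain graph is a finite directed multigraph \<open>H\<close> (locale \<^locale>\<open>fin_digraph\<close>, which admits loops and
  parallel arcs) with a gain function \<open>\<psi>\<close> on its arcs. Gain groups are written additively, so the
  identity is \<open>0\<close> and the group \<open>\<int>/2\<int>\<close> is the type \<^typ>\<open>bit\<close>.
\<close>

text \<open>
  An arc \<open>(e, b)\<close> is the edge \<open>e\<close> traversed forwards (\<open>b\<close> false) or backwards (\<open>b\<close> true).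
\<close>
definition traversals :: "('v, 'e) pre_digraph \<Rightarrow> ('v, 'e \<times> bool) pre_digraph" where
  "traversals H =
     \<lparr>verts = verts H,
      arcs = arcs H \<times> UNIV,
      tail = (\<lambda>(e, b). if b then head H e else tail H e),
      head = (\<lambda>(e, b). if b then tail H e else head H e)\<rparr>"

text \<open>
  Distinctness of the underlying edges excludes walking back and forth along one edge.
\<close>
definition undirected_cycle :: "('v, 'e) pre_digraph \<Rightarrow> ('e \<times> bool) list \<Rightarrow> bool" where
  "undirected_cycle H c \<longleftrightarrow> pre_digraph.cycle (traversals H) c \<and> distinct (map fst c)"

definition walk_gain :: "('e \<Rightarrow> 'g::group_add) \<Rightarrow> ('e \<times> bool) list \<Rightarrow> 'g" where
  "walk_gain \<psi> c = sum_list (map (\<lambda>(e, b). if b then - \<psi> e else \<psi> e) c)"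

definition balanced :: "('v, 'e) pre_digraph \<Rightarrow> ('e \<Rightarrow> 'g::group_add) \<Rightarrow> 'e set \<Rightarrow> bool" where
  "balanced H \<psi> F \<longleftrightarrow>
     (\<forall>c. undirected_cycle H c \<and> fst ` set c \<subseteq> F \<longrightarrow> walk_gain \<psi> c = 0)"

definition endpoints :: "('v, 'e) pre_digraph \<Rightarrow> 'e set \<Rightarrow> 'v set" where
  "endpoints H F = tail H ` F \<union> head H ` F"

definition gain_sparse ::
  "nat \<Rightarrow> nat \<Rightarrow> nat \<Rightarrow> ('v, 'e) pre_digraph \<Rightarrow> ('e \<Rightarrow> 'g::group_add) \<Rightarrow> bool" where
  "gain_sparse k l m H \<psi> \<longleftrightarrow>
     (\<forall>F. F \<subseteq> arcs H \<and> F \<noteq> {} \<and> balanced H \<psi> F \<longrightarrow>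
        int (card F) \<le> int k * int (card (endpoints H F)) - int l) \<and>
     (\<forall>F. F \<subseteq> arcs H \<and> F \<noteq> {} \<longrightarrow>
        int (card F) \<le> int k * int (card (endpoints H F)) - int m)"

section \<open>Point group\<close>

text \<open>The identity and the half-turn about the origin.\<close>
definition half_turn_group :: "(real^2^2) set" where
  "half_turn_group = {mat 1, - mat 1}"

definition faithful_representation :: "('g::group_add \<Rightarrow> real^'n^'n) \<Rightarrow> (real^'n^'n) set \<Rightarrow> bool" where
  "faithful_representation \<tau> S \<longleftrightarrow>
     range \<tau> \<subseteq> S \<and> (\<forall>g h. \<tau> (g + h) = \<tau> g ** \<tau> h) \<and> inj \<tau>"

section \<open>Rigidity matrices\<close>

text \<open>
  A row of a matrix with two columns per vertex is an element of \<^typ>\<open>real^2^'v\<close>, whose component at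
  \<open>v\<close> is the pair of entries in the columns of \<open>v\<close>. The columns range over the whole vertex type, so
  those of indices outside the vertex set are zero and affect neither rank nor independence.
  The vector \<open>axis v x\<close> has \<open>x\<close> in the columns of \<open>v\<close> and \<open>0\<close> elsewhere, and adding two such vectors
  yields the prescribed entries also when both ends of an edge coincide.
\<close>

definition orbit_matrix_row ::
  "('v::finite, 'e) pre_digraph \<Rightarrow> (bit \<Rightarrow> real^2^2) \<Rightarrow> ('e \<Rightarrow> bit) \<Rightarrow> ('v \<Rightarrow> real^2) \<Rightarrow> 'e \<Rightarrow> real^2^'v"
  where
  "orbit_matrix_row H \<tau> \<psi> p e =
     (let u = tail H e; v = head H e; s = (if \<psi> e = 0 then 1 else - 1 :: real) in
        axis u (p u - \<tau> (\<psi> e) *v p v) +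
        axis v (s *\<^sub>R (p v - matrix_inv (\<tau> (\<psi> e)) *v p u)))"

text \<open>
  Linear independence of the rows as a family indexed by the edges, so equal rows are dependent.
\<close>
definition row_independent :: "'e set \<Rightarrow> ('e \<Rightarrow> 'a::real_vector) \<Rightarrow> bool" where
  "row_independent E M \<longleftrightarrow> inj_on M E \<and> independent (M ` E)"

text \<open>
  The edges of the covering graph as sets \<open>{x, y}\<close> of vertices (a singleton when degenerate). Identifying
  parallel edges does not change the rank of the rigidity matrix, as their rows are equal.
\<close>
definition covering_edges ::
  "('v, 'e) pre_digraph \<Rightarrow> ('e \<Rightarrow> 'g::group_add) \<Rightarrow> ('g \<times> 'v) set set" where
  "covering_edges H \<psi> = {{(g, tail H e), (g + \<psi> e, head H e)} | g e. e \<in> arcs H}"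

text \<open>
  The row of the edge \<open>{u, v}\<close>, symmetric in \<open>u\<close> and \<open>v\<close>, and zero if \<open>u = v\<close>.
\<close>
definition rigidity_matrix_row :: "('w::finite \<Rightarrow> real^2) \<Rightarrow> 'w \<Rightarrow> 'w \<Rightarrow> real^2^'w" where
  "rigidity_matrix_row p u v = axis u (p u - p v) + axis v (p v - p u)"

definition rigidity_rank :: "'w set set \<Rightarrow> ('w::finite \<Rightarrow> real^2) \<Rightarrow> nat" where
  "rigidity_rank E p = dim {rigidity_matrix_row p u v | u v. {u, v} \<in> E}"

definition symmetric_lift :: "('g \<Rightarrow> real^2^2) \<Rightarrow> ('v \<Rightarrow> real^2) \<Rightarrow> 'g \<times> 'v \<Rightarrow> real^2" where
  "symmetric_lift \<tau> p = (\<lambda>(g, v). \<tau> g *v p v)"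

definition symmetric_regular ::
  "('v::finite, 'e) pre_digraph \<Rightarrow> ('g::{group_add, finite} \<Rightarrow> real^2^2) \<Rightarrow> ('e \<Rightarrow> 'g) \<Rightarrow>
     ('v \<Rightarrow> real^2) \<Rightarrow> bool" where
  "symmetric_regular H \<tau> \<psi> p \<longleftrightarrow>
     (\<forall>q. rigidity_rank (covering_edges H \<psi>) (symmetric_lift \<tau> q)
        \<le> rigidity_rank (covering_edges H \<psi>) (symmetric_lift \<tau> p))"

end

theory Submission
  imports Defs
begin

text \<open>
  Since \<open>\<tau> g\<close> is the scalar \<open>\<plusminus>1\<close>, the row of an edge \<open>e = (u, v)\<close> is \<open>d\<close> at \<open>u\<close> and \<open>- d\<close> at \<open>v\<close>, where
  \<open>d = p u - sg (\<psi> e) p v\<close>. All rows are therefore orthogonal to the two translations, and on a balanced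
  edge set also to a switched rotation, which makes the sparsity counts necessary.

  Conversely, a sparse gain graph has a vertex of degree at most three. Deleting it, and if its degree is
  three replacing it by an edge between two of its neighbours, leaves a smaller sparse gain graph, since
  otherwise the tight sets that forbid all possible edges could be combined to violate a count. A placement
  with independent rows extends to the deleted vertex as soon as finitely many lines are avoided. This is
  harmless: along a line of placements independence fails for finitely many parameters only.

  Finally, the rigidity matrix of the covering graph splits into a symmetric and an antisymmetric part, the
  latter being the orbit matrix. Both attain their maximal ranks simultaneously, so both do at a regular
  placement.
\<close>

section \<open>Row independence along a line of placements\<close>

lemma row_independent_iff:
  fixes M :: "'e \<Rightarrow> 'a::euclidean_space"
  assumes "finite E"
  shows "row_independent E M \<longleftrightarrow> (\<forall>c. (\<Sum>e\<in>E. c e *\<^sub>R M e) = 0 \<longrightarrow> (\<forall>e\<in>E. c e = 0))"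
proof
  assume L: "row_independent E M"
  then have inj: "inj_on M E" and ind: "independent (M ` E)"
    by (auto simp: row_independent_def)
  show "\<forall>c. (\<Sum>e\<in>E. c e *\<^sub>R M e) = 0 \<longrightarrow> (\<forall>e\<in>E. c e = 0)"
  proof (intro allI impI ballI)
    fix c e assume s: "(\<Sum>e\<in>E. c e *\<^sub>R M e) = 0" and e: "e \<in> E"
    have s': "(\<Sum>x\<in>M ` E. c (inv_into E M x) *\<^sub>R x) = 0"
      using s inj by (simp add: sum.reindex)
    have "\<forall>c. (\<Sum>x\<in>M ` E. c x *\<^sub>R x) = 0 \<longrightarrow> (\<forall>x\<in>M ` E. c x = 0)"
      using ind unfolding independent_explicit by blast
    from this[rule_format, of "\<lambda>x. c (inv_into E M x)", OF s'] e
    have "c (inv_into E M (M e)) = 0" by blast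
    then show "c e = 0" using inj e by simp
  qed
next
  assume R: "\<forall>c. (\<Sum>e\<in>E. c e *\<^sub>R M e) = 0 \<longrightarrow> (\<forall>e\<in>E. c e = 0)"
  have inj: "inj_on M E"
  proof (rule inj_onI, rule ccontr)
    fix x y assume *: "x \<in> E" "y \<in> E" "M x = M y" "x \<noteq> y"
    let ?c = "\<lambda>e. (if e = x then 1 else 0) - (if e = y then 1 else 0) :: real"
    have "(\<Sum>e\<in>E. ?c e *\<^sub>R M e) = (\<Sum>e\<in>E. (if e = x then M x else 0) - (if e = y then M y else 0))"
      by (intro sum.cong) auto
    also have "\<dots> = 0" using * assms by (simp add: sum_subtractf)
    finally have "?c x = 0" using R[rule_format, of ?c x] * by blast
    then show False using * by simp
  qed
  have "independent (M ` E)"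
    unfolding independent_explicit
  proof (intro conjI allI impI ballI)
    show "finite (M ` E)" using assms by simp
    fix c x assume "(\<Sum>v\<in>M ` E. c v *\<^sub>R v) = 0" "x \<in> M ` E"
    then show "c x = 0" using R[rule_format, of "\<lambda>e. c (M e)"] inj
      by (auto simp: sum.reindex)
  qed
  then show "row_independent E M" using inj by (simp add: row_independent_def)
qed

lemma row_independentI:
  fixes M :: "'e \<Rightarrow> 'a::euclidean_space"
  assumes "finite E" "\<And>c e. (\<Sum>e\<in>E. c e *\<^sub>R M e) = 0 \<Longrightarrow> e \<in> E \<Longrightarrow> c e = 0"
  shows "row_independent E M"
  using assms by (auto simp: row_independent_iff)

lemma row_independentD:
  fixes M :: "'e \<Rightarrow> 'a::euclidean_space"
  assumes "row_independent E M" "finite E" "(\<Sum>e\<in>E. c e *\<^sub>R M e) = 0" "e \<in> E"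
  shows "c e = 0"
  using assms by (auto simp: row_independent_iff)

lemma row_independent_mono:
  "row_independent E M \<Longrightarrow> F \<subseteq> E \<Longrightarrow> row_independent F M"
  unfolding row_independent_def by (meson inj_on_subset image_mono independent_mono)

text \<open>Gaussian elimination without division, so that the reduced family is again polynomial in \<open>t\<close>.\<close>
lemma finite_dependent_parameters:
  fixes r :: "'e \<Rightarrow> real \<Rightarrow> 'a::euclidean_space"
  assumes "finite E" and "\<And>e w. e \<in> E \<Longrightarrow> \<exists>P. \<forall>t. r e t \<bullet> w = poly P t"
    and "row_independent E (\<lambda>e. r e t0)"
  shows "finite {t. \<not> row_independent E (\<lambda>e. r e t)}"
  using assms
proof (induction E arbitrary: r rule: finite_induct)
  case empty
  then show ?case by (simp add: row_independent_def)
next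
  case (insert a E)
  \<comment> \<open>The pivot direction: at \<open>t0\<close> the factor
    \<open>r a t \<bullet> w\<close> is the squared norm of the nonzero vector
    \<open>r a t0\<close>, so it is a nonzero polynomial in \<open>t\<close>.\<close>
  define w where "w = r a t0"
  define r' where "r' = (\<lambda>e t. (r a t \<bullet> w) *\<^sub>R r e t - (r e t \<bullet> w) *\<^sub>R r a t)"
  have fin: "finite (insert a E)" using insert.hyps by simp
  have "w \<noteq> 0"
  proof
    assume "w = 0"
    then have "(\<Sum>e\<in>insert a E. (if e = a then 1 else 0) *\<^sub>R r e t0) = 0"
      unfolding w_def by (intro sum.neutral) auto
    from row_independentD[OF insert.prems(2) fin this, of a] show False by simp
  qed
  obtain P where P: "\<And>t. r a t \<bullet> w = poly P t" using insert.prems(1) by blast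
  have "poly P t0 \<noteq> 0" using P[of t0] \<open>w \<noteq> 0\<close> by (metis inner_eq_zero_iff w_def)
  then have finP: "finite {t. poly P t = 0}" by (intro poly_roots_finite) auto
  have sumE: "(\<Sum>e\<in>E. c e *\<^sub>R r' e t) =
      (r a t \<bullet> w) *\<^sub>R (\<Sum>e\<in>E. c e *\<^sub>R r e t) - ((\<Sum>e\<in>E. c e *\<^sub>R r e t) \<bullet> w) *\<^sub>R r a t" for c t
    unfolding r'_def by (simp add: scaleR_diff_right sum_subtractf scaleR_sum_right
        scaleR_sum_left inner_sum_left mult.commute)
  have "finite {t. \<not> row_independent E (\<lambda>e. r' e t)}"
  proof (rule insert.IH)
    fix e v assume e: "e \<in> E"
    obtain P1 P2 P3 where "\<And>t. r e t \<bullet> v = poly P1 t" "\<And>t. r e t \<bullet> w = poly P2 t"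
      "\<And>t. r a t \<bullet> v = poly P3 t" using insert.prems(1) e by (meson insertCI)
    then have "\<forall>t. r' e t \<bullet> v = poly (P * P1 - P2 * P3) t"
      unfolding r'_def using P by (simp add: inner_diff_left)
    then show "\<exists>Q. \<forall>t. r' e t \<bullet> v = poly Q t" by blast
  next
    show "row_independent E (\<lambda>e. r' e t0)"
    proof (rule row_independentI[OF insert.hyps(1)])
      fix c e assume s: "(\<Sum>e\<in>E. c e *\<^sub>R r' e t0) = 0" and e: "e \<in> E"
      let ?k = "- ((\<Sum>e\<in>E. c e *\<^sub>R r e t0) \<bullet> w)"
      let ?c = "\<lambda>e. if e = a then ?k else (r a t0 \<bullet> w) * c e"
      have "(\<Sum>e\<in>insert a E. ?c e *\<^sub>R r e t0) = ?k *\<^sub>R r a t0 + (\<Sum>e\<in>E. ((r a t0 \<bullet> w) * c e) *\<^sub>R r e t0)"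
        using insert.hyps by (simp, intro sum.cong, auto)
      also have "\<dots> = 0" using s unfolding sumE by (simp add: scaleR_sum_right)
      finally have "?c e = 0"
        using row_independentD[OF insert.prems(2) fin, where c = ?c and e = e] e by blast
      then show "c e = 0" using e insert.hyps P[of t0] \<open>poly P t0 \<noteq> 0\<close> by (auto split: if_splits)
    qed
  qed
  \<comment> \<open>Away from the roots of \<open>P\<close>, a dependency of the original rows
    restricts to one of the reduced rows, and then only row \<open>a\<close> with
    \<open>r a t \<noteq> 0\<close> is left.\<close>
  moreover have "{t. \<not> row_independent (insert a E) (\<lambda>e. r e t)} \<subseteq>
      {t. \<not> row_independent E (\<lambda>e. r' e t)} \<union> {t. poly P t = 0}"
  proof (rule subsetI, rule ccontr)
    fix t assume t: "t \<in> {t. \<not> row_independent (insert a E) (\<lambda>e. r e t)}"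
      "t \<notin> {t. \<not> row_independent E (\<lambda>e. r' e t)} \<union> {t. poly P t = 0}"
    have "row_independent (insert a E) (\<lambda>e. r e t)"
    proof (rule row_independentI[OF fin])
      fix c e assume s: "(\<Sum>e\<in>insert a E. c e *\<^sub>R r e t) = 0" and e: "e \<in> insert a E"
      then have s': "(\<Sum>e\<in>E. c e *\<^sub>R r e t) = - c a *\<^sub>R r a t"
        using insert.hyps by (simp add: eq_neg_iff_add_eq_0 add.commute)
      have "(\<Sum>e\<in>E. c e *\<^sub>R r' e t) = 0" unfolding sumE s' by simp
      then have z: "c e = 0" if "e \<in> E" for e
        using t row_independentD[OF _ insert.hyps(1)] that by blast
      then have "c a *\<^sub>R r a t = 0" using s' by simp
      moreover have "r a t \<noteq> 0" using t P[of t] by auto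
      ultimately have "c a = 0" by simp
      then show "c e = 0" using z e by auto
    qed
    then show False using t by simp
  qed
  ultimately show ?case using finP by (meson finite_UnI finite_subset)
qed

lemma linear_line_polynomial:
  fixes f :: "'p::real_vector \<Rightarrow> 'a::euclidean_space"
  assumes "linear f"
  shows "\<exists>P. \<forall>t. f (p + t *\<^sub>R d) \<bullet> w = poly P t"
proof (intro exI allI)
  show "f (p + t *\<^sub>R d) \<bullet> w = poly [:f p \<bullet> w, f d \<bullet> w:] t" for t
    using assms by (simp add: linear_add linear_scale inner_add_left)
qed

text \<open>On the line from \<open>p\<close> to \<open>q\<close> the first condition holds at
  parameter 0 and the second at 1, so each fails for finitely many parameters only. Generic
  requirements can thus be met one at a time, by unrelated witnesses.\<close>

lemma common_row_independent_parameter: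
  fixes L1 :: "'e \<Rightarrow> 'p::real_vector \<Rightarrow> 'a::euclidean_space"
    and L2 :: "'f \<Rightarrow> 'p \<Rightarrow> 'b::euclidean_space"
  assumes "finite E" "finite F" and "\<And>e. linear (L1 e)" "\<And>f. linear (L2 f)"
    and "row_independent E (\<lambda>e. L1 e p)" "row_independent F (\<lambda>f. L2 f q)"
  shows "\<exists>x. row_independent E (\<lambda>e. L1 e x) \<and> row_independent F (\<lambda>f. L2 f x)"
proof -
  define l where "l t = p + t *\<^sub>R (q - p)" for t :: real
  have "finite {t. \<not> row_independent E (\<lambda>e. L1 e (l t))}"
    by (rule finite_dependent_parameters[where ?t0.0 = 0])
      (use assms in \<open>auto simp: l_def intro: linear_line_polynomial\<close>)
  moreover have "finite {t. \<not> row_independent F (\<lambda>e. L2 e (l t))}"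
    by (rule finite_dependent_parameters[where ?t0.0 = 1])
      (use assms in \<open>auto simp: l_def intro: linear_line_polynomial\<close>)
  ultimately have "finite ({t. \<not> row_independent E (\<lambda>e. L1 e (l t))} \<union> {t. \<not> row_independent F (\<lambda>e. L2 e (l t))})"
    by simp
  then obtain t where "t \<notin> {t. \<not> row_independent E (\<lambda>e. L1 e (l t))} \<union> {t. \<not> row_independent F (\<lambda>e. L2 e (l t))}"
    using infinite_UNIV_char_0 by (metis ex_new_if_finite)
  then show ?thesis by blast
qed

section \<open>Balanced edge sets and potentials\<close>

text \<open>A switching function that makes every gain in \<open>F\<close> trivial. Elements of the
  group are their own inverses, so the orientation of an edge is immaterial.\<close>

definition potential :: "('e \<Rightarrow> 'v) \<Rightarrow> ('e \<Rightarrow> 'v) \<Rightarrow> ('e \<Rightarrow> bit) \<Rightarrow> 'e set \<Rightarrow> ('v \<Rightarrow> bit) \<Rightarrow> bool" where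
  "potential t h \<psi> F \<sigma> \<longleftrightarrow> (\<forall>e\<in>F. \<psi> e = \<sigma> (t e) + \<sigma> (h e))"

lemma bit_add_self [simp]: "a + a = (0 :: bit)" "a + (a + b) = (b :: bit)"
  by (cases a; cases b; simp)+

lemma bit_add_eq_0_iff: "a + b = (0 :: bit) \<longleftrightarrow> a = b"
  by (cases a; cases b; simp)

text \<open>The gains telescope; a backward step contributes the same as a forward one.\<close>

lemma walk_gain_potential:
  assumes "pre_digraph.cas (traversals H) u c w" "fst ` set c \<subseteq> F"
    "potential (tail H) (head H) \<psi> F \<sigma>"
  shows "walk_gain \<psi> c = \<sigma> u + \<sigma> w"
  using assms(1,2)
proof (induction c arbitrary: u)
  case Nil
  then show ?case by (simp add: pre_digraph.cas.simps walk_gain_def)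
next
  case (Cons a c)
  obtain e b where a: "a = (e, b)" by fastforce
  have e: "\<psi> e = \<sigma> (tail H e) + \<sigma> (head H e)"
    using Cons.prems a assms(3) by (auto simp: potential_def)
  have "walk_gain \<psi> c = \<sigma> (if b then tail H e else head H e) + \<sigma> w"
    using Cons a by (auto simp: pre_digraph.cas.simps traversals_def)
  moreover have "u = (if b then head H e else tail H e)"
    using Cons.prems a by (auto simp: pre_digraph.cas.simps traversals_def)
  ultimately show ?case using e a by (auto simp: walk_gain_def algebra_simps)
qed

lemma balanced_if_potential:
  assumes "potential (tail H) (head H) \<psi> F \<sigma>"
  shows "balanced H \<psi> F"
  unfolding balanced_def
proof (intro allI impI, elim conjE)
  fix c assume c: "undirected_cycle H c" "fst ` set c \<subseteq> F"
  then obtain u where "pre_digraph.cas (traversals H) u c u"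
    by (auto simp: undirected_cycle_def pre_digraph.cycle_def pre_digraph.awalk_def)
  from walk_gain_potential[OF this c(2) assms] show "walk_gain \<psi> c = 0" by simp
qed

context
  fixes H :: "('v, 'e) pre_digraph"
  assumes wf: "wf_digraph H"
begin

lemma wf_traversals: "A \<subseteq> arcs H \<Longrightarrow> wf_digraph (traversals (H\<lparr>arcs := A\<rparr>))"
  using wf unfolding wf_digraph_def traversals_def by (auto split: if_splits)

text \<open>The first vertex of a path does not recur, whereas reusing the first edge, in either
  direction, would meet that vertex again.\<close>

lemma apath_traversals_distinct:
  assumes A: "A \<subseteq> arcs H" and "pre_digraph.apath (traversals (H\<lparr>arcs := A\<rparr>)) u c w"
  shows "distinct (map fst c)"
  using assms(2)
proof (induction c arbitrary: u)
  case (Cons a c)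
  let ?T = "traversals (H\<lparr>arcs := A\<rparr>)"
  interpret T: wf_digraph ?T by (rule wf_traversals[OF A])
  obtain e b where a: "a = (e, b)" by fastforce
  have tl: "T.apath (head ?T a) c w" and u: "tail ?T a = u" "u \<notin> set (T.awalk_verts (head ?T a) c)"
    using Cons.prems by (auto simp: T.apath_Cons_iff)
  have c: "tail ?T x \<in> set (T.awalk_verts (head ?T a) c) \<and> head ?T x \<in> set (T.awalk_verts (head ?T a) c)"
    if "x \<in> set c" for x
  proof -
    have "T.cas (head ?T a) c w" using tl by (auto simp: T.apath_def T.awalk_def)
    from T.awalk_verts_conv'[OF this]
    have "head ?T x \<in> set (T.awalk_verts (head ?T a) c)" using that by auto
    moreover have "tail ?T x \<in> set (T.awalk_verts (head ?T a) c)"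
      using that by (subst T.awalk_verts_conv) auto
    ultimately show ?thesis by blast
  qed
  have "e \<notin> fst ` set c"
  proof
    assume "e \<in> fst ` set c"
    then obtain b' where "(e, b') \<in> set c" by auto
    from c[OF this] u a show False by (cases b; cases b') (auto simp: traversals_def)
  qed
  then show ?case using Cons.IH[OF tl] a by simp
qed simp

text \<open>Edges are added one at a time. If the ends of the new edge are already connected, it
  closes a path to a cycle, whose zero gain forces the required equation. Otherwise the potential
  can be shifted on one component without disturbing the old edges.\<close>

lemma potential_if_balanced:
  assumes "finite F" "F \<subseteq> arcs H" "balanced H \<psi> F"
  shows "\<exists>\<sigma>. potential (tail H) (head H) \<psi> F \<sigma>"
  using assms
proof (induction F rule: finite_induct)
  case empty
  then show ?case by (auto simp: potential_def)
next
  case (insert e F)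
  have "balanced H \<psi> F" using insert.prems(2) by (auto simp: balanced_def)
  then obtain \<sigma> where \<sigma>: "potential (tail H) (head H) \<psi> F \<sigma>" using insert by auto
  have F: "F \<subseteq> arcs H" and e: "e \<in> arcs H" using insert.prems by auto
  let ?T = "traversals (H\<lparr>arcs := F\<rparr>)"
  let ?T' = "traversals H"
  interpret T: wf_digraph ?T by (rule wf_traversals[OF F])
  interpret H: wf_digraph H by (rule wf)
  have "wf_digraph (traversals (H\<lparr>arcs := arcs H\<rparr>))" by (rule wf_traversals) simp
  then interpret T': wf_digraph ?T' by simp
  have arcsT: "arcs ?T = F \<times> UNIV" and tT: "tail ?T = tail ?T'" "head ?T = head ?T'" "verts ?T = verts ?T'"
    by (simp_all add: traversals_def fun_eq_iff split_beta)
  have arcsT': "arcs ?T' = arcs H \<times> UNIV" "verts ?T' = verts H"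
    by (simp_all add: traversals_def)
  show ?case
  proof (cases "tail H e \<rightarrow>\<^sup>*\<^bsub>?T\<^esub> head H e")
    case True
    then obtain c where c: "T.apath (tail H e) c (head H e)"
      using T.reachable_apath by blast
    have sub: "set c \<subseteq> F \<times> UNIV" using c by (auto simp: T.apath_def T.awalk_def arcsT)
    then have "fst ` set c \<subseteq> F" by auto
    have cas_eq: "T.cas = T'.cas"
    proof (intro ext)
      show "T.cas x p y = T'.cas x p y" for x p y
        by (induction p arbitrary: x) (simp_all add: tT)
    qed
    have vs_eq: "T.awalk_verts x p = T'.awalk_verts x p" for x p
      by (simp add: T.awalk_verts_conv T'.awalk_verts_conv tT)
    have cas: "T'.cas (tail H e) c (head H e)"
      using c by (simp add: T.apath_def T.awalk_def cas_eq)
    have g: "walk_gain \<psi> c = \<sigma> (tail H e) + \<sigma> (head H e)"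
      by (rule walk_gain_potential[OF cas \<open>fst ` set c \<subseteq> F\<close> \<sigma>])
    \<comment> \<open>The path runs from tail to head of \<open>e\<close>, so \<open>e\<close> is
      traversed backwards to return.\<close>
    let ?c = "c @ [(e, True)]"
    have te: "tail ?T' (e, True) = head H e" "head ?T' (e, True) = tail H e"
      by (simp_all add: traversals_def)
    have "T'.awalk (tail H e) c (head H e)"
      using cas sub F e unfolding T'.awalk_def arcsT' by auto
    moreover have "T'.awalk (head H e) [(e, True)] (tail H e)"
      using e by (simp add: T'.awalk_def te arcsT')
    ultimately have aw: "T'.awalk (tail H e) ?c (tail H e)" by (simp add: T'.awalk_appendI)
    have "T'.awalk_verts (tail H e) ?c = T'.awalk_verts (tail H e) c @ [tail H e]"
      using T'.awlast_if_cas[OF cas] by (cases c rule: rev_cases) (auto simp: T'.awalk_verts_conv te)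
    moreover have "distinct (T'.awalk_verts (tail H e) c)" using c by (simp add: T.apath_def vs_eq)
    moreover have "T'.awalk_verts (tail H e) c = tail H e # tl (T'.awalk_verts (tail H e) c)"
      using T'.awhd_if_cas[OF cas] by (metis T'.awalk_verts_non_Nil list.collapse)
    ultimately have "distinct (tl (T'.awalk_verts (tail H e) ?c))"
      by (cases "T'.awalk_verts (tail H e) c") auto
    with aw have "T'.cycle ?c" by (auto simp: T'.cycle_def)
    moreover have "distinct (map fst ?c)"
      using apath_traversals_distinct[OF F c] \<open>fst ` set c \<subseteq> F\<close> insert.hyps by auto
    ultimately have "walk_gain \<psi> ?c = 0"
      using insert.prems(2)[unfolded balanced_def, rule_format, of ?c] \<open>fst ` set c \<subseteq> F\<close>
      by (auto simp: undirected_cycle_def)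
    then have "walk_gain \<psi> c + \<psi> e = 0" by (simp add: walk_gain_def)
    then have "\<psi> e = \<sigma> (tail H e) + \<sigma> (head H e)" using g by (simp add: bit_add_eq_0_iff)
    then show ?thesis using \<sigma> by (auto simp: potential_def)
  next
    case False
    \<comment> \<open>\<open>d\<close> is the error of \<open>\<sigma>\<close> on \<open>e\<close>.
      Adding it on the component of \<open>tail H e\<close> repairs \<open>e\<close>, whose head
      lies outside, and affects both ends of an edge of \<open>F\<close> or neither.\<close>
    define d where "d = \<psi> e + \<sigma> (tail H e) + \<sigma> (head H e)"
    define \<sigma>' where "\<sigma>' w = (if tail H e \<rightarrow>\<^sup>*\<^bsub>?T\<^esub> w then \<sigma> w + d else \<sigma> w)" for w
    have "tail H e \<rightarrow>\<^sup>*\<^bsub>?T\<^esub> tail H e"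
      using e by (intro T.reachable_refl) (simp add: traversals_def)
    then have "\<psi> e = \<sigma>' (tail H e) + \<sigma>' (head H e)"
      using False by (auto simp: \<sigma>'_def d_def algebra_simps)
    moreover have "\<psi> f = \<sigma>' (tail H f) + \<sigma>' (head H f)" if f: "f \<in> F" for f
    proof -
      have "(f, b) \<in> arcs ?T" for b using f by (simp add: arcsT)
      then have "(tail ?T (f, b), head ?T (f, b)) \<in> arcs_ends ?T" for b
        unfolding arcs_ends_conv by (rule imageI)
      from this[of False] this[of True]
      have "tail H f \<rightarrow>\<^bsub>?T\<^esub> head H f" "head H f \<rightarrow>\<^bsub>?T\<^esub> tail H f"
        by (simp_all add: traversals_def)
      then have "tail H e \<rightarrow>\<^sup>*\<^bsub>?T\<^esub> tail H f \<longleftrightarrow> tail H e \<rightarrow>\<^sup>*\<^bsub>?T\<^esub> head H f"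
        using T.reachable_adj_trans by blast
      then show ?thesis using \<sigma> f by (auto simp: \<sigma>'_def potential_def algebra_simps)
    qed
    ultimately have "potential (tail H) (head H) \<psi> (insert e F) \<sigma>'" by (auto simp: potential_def)
    then show ?thesis by blast
  qed
qed

end

section \<open>Sparse gain graphs\<close>

text \<open>Gain-sparsity with balance expressed by potentials and without subtraction. It takes the
  end maps and gains as functions, so that a reduction can redirect a single edge by function
  update.\<close>

definition sparse :: "('e \<Rightarrow> 'v) \<Rightarrow> ('e \<Rightarrow> 'v) \<Rightarrow> ('e \<Rightarrow> bit) \<Rightarrow> 'e set \<Rightarrow> bool" where
  "sparse t h \<psi> E \<longleftrightarrow> (\<forall>F. F \<subseteq> E \<and> F \<noteq> {} \<longrightarrow>
     card F + 2 \<le> 2 * card (t ` F \<union> h ` F) \<and>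
     ((\<exists>\<sigma>. potential t h \<psi> F \<sigma>) \<longrightarrow> card F + 3 \<le> 2 * card (t ` F \<union> h ` F)))"

lemma sparse_mono: "sparse t h \<psi> E \<Longrightarrow> F \<subseteq> E \<Longrightarrow> sparse t h \<psi> F"
  unfolding sparse_def by blast

lemma potential_mono: "potential t h \<psi> E \<sigma> \<Longrightarrow> F \<subseteq> E \<Longrightarrow> potential t h \<psi> F \<sigma>"
  unfolding potential_def by blast

lemma sparse_bound:
  fixes W :: "'v::finite set"
  assumes "sparse t h \<psi> E" "F \<subseteq> E" "t ` F \<union> h ` F \<subseteq> W" "W \<noteq> {}"
  shows "card F + 2 \<le> 2 * card W"
proof (cases "F = {}")
  case True
  moreover have "card W > 0" using assms(4) by (simp add: card_gt_0_iff)
  then have "2 \<le> 2 * card W" by linarith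
  ultimately show ?thesis by simp
next
  case False
  then have "card F + 2 \<le> 2 * card (t ` F \<union> h ` F)"
    using assms(1)[unfolded sparse_def, rule_format, of F] assms(2) by blast
  also have "\<dots> \<le> 2 * card W" using assms(3) by (simp add: card_mono)
  finally show ?thesis .
qed

text \<open>Two vertices are demanded because an empty edge set on a single vertex would break the
  bound.\<close>

lemma sparse_bound_potential:
  fixes W :: "'v::finite set"
  assumes "sparse t h \<psi> E" "F \<subseteq> E" "t ` F \<union> h ` F \<subseteq> W" "card W \<ge> 2" "potential t h \<psi> F \<sigma>"
  shows "card F + 3 \<le> 2 * card W"
proof (cases "F = {}")
  case False
  then have "card F + 3 \<le> 2 * card (t ` F \<union> h ` F)"
    using assms(1)[unfolded sparse_def, rule_format, of F] assms(2,5) by blast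
  also have "\<dots> \<le> 2 * card W" using assms(3) by (simp add: card_mono)
  finally show ?thesis .
qed (use assms(4) in simp)

lemma sparse_no_loop:
  assumes "sparse t h \<psi> E" "e \<in> E"
  shows "t e \<noteq> h e"
proof
  assume "t e = h e"
  moreover have "card {e} + 2 \<le> 2 * card (t ` {e} \<union> h ` {e})"
    using assms(1)[unfolded sparse_def, rule_format, of "{e}"] assms(2) by blast
  ultimately show False by simp
qed

text \<open>Two such edges would form a balanced set on two vertices, and 2 + 3 exceeds 4.\<close>

lemma sparse_no_parallel:
  assumes "sparse t h \<psi> E" "e \<in> E" "f \<in> E" "t e = t f" "h e = h f" "\<psi> e = \<psi> f"
  shows "e = f"
proof (rule ccontr)
  assume "e \<noteq> f"
  have "potential t h \<psi> {e, f} (\<lambda>w. if w = h e then \<psi> e else 0)"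
    using assms sparse_no_loop[OF assms(1,2)] by (auto simp: potential_def)
  then have "card {e, f} + 3 \<le> 2 * card (t ` {e, f} \<union> h ` {e, f})"
    using assms(1)[unfolded sparse_def, rule_format, of "{e, f}"] assms(2,3) by blast
  moreover have "t ` {e, f} \<union> h ` {e, f} = {t e, h e}" using assms by auto
  ultimately show False using \<open>e \<noteq> f\<close> sparse_no_loop[OF assms(1,2)] by simp
qed

text \<open>Without loops the degrees sum to twice the number of edges, which is less than four
  times the number of vertices.\<close>

lemma sparse_low_degree:
  fixes t h :: "'e \<Rightarrow> 'v::finite"
  assumes "sparse t h \<psi> E" "finite E" "E \<noteq> {}"
  shows "\<exists>v. {e \<in> E. t e = v \<or> h e = v} \<noteq> {} \<and> card {e \<in> E. t e = v \<or> h e = v} \<le> 3"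
proof (rule ccontr)
  assume "\<not> ?thesis"
  then have deg: "card {e \<in> E. t e = v \<or> h e = v} \<ge> 4" if "v \<in> t ` E \<union> h ` E" for v
    using that by force
  let ?V = "t ` E \<union> h ` E"
  have "{v \<in> ?V. t e = v \<or> h e = v} = {t e, h e}" if "e \<in> E" for e
    using that by auto
  then have "card {v \<in> ?V. t e = v \<or> h e = v} = 2" if "e \<in> E" for e
    using that sparse_no_loop[OF assms(1)] by simp
  then have "(\<Sum>v\<in>?V. card {e \<in> E. t e = v \<or> h e = v}) = (\<Sum>e\<in>E. 2)"
    by (intro sum_multicount_gen) (use assms in auto)
  moreover have "(\<Sum>v\<in>?V. 4) \<le> (\<Sum>v\<in>?V. card {e \<in> E. t e = v \<or> h e = v})"
    by (intro sum_mono deg)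
  moreover have "card E + 2 \<le> 2 * card ?V" using assms(1)[unfolded sparse_def, rule_format, of E] assms(3) by blast
  ultimately show False by simp
qed

lemma sparse_reorient:
  fixes t h :: "'a \<Rightarrow> 'b"
  assumes "\<And>e. (t' e = t e \<and> h' e = h e) \<or> (t' e = h e \<and> h' e = t e)"
  shows "sparse t' h' \<psi> E \<longleftrightarrow> sparse t h \<psi> E"
proof -
  have "{t' e, h' e} = {t e, h e}" for e using assms[of e] by auto
  then have "(\<Union>e\<in>F. {t' e, h' e}) = (\<Union>e\<in>F. {t e, h e})" for F by simp
  moreover have "(\<Union>e\<in>F. {f e, g e}) = f ` F \<union> g ` F" for f g :: "'a \<Rightarrow> 'b" and F
    by auto
  ultimately have "t' ` F \<union> h' ` F = t ` F \<union> h ` F" for F by metis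
  moreover have "\<sigma> (t' e) + \<sigma> (h' e) = \<sigma> (t e) + \<sigma> (h e)" for \<sigma> :: "'b \<Rightarrow> bit" and e
    using assms[of e] by (auto simp: add.commute)
  then have "potential t' h' \<psi> = potential t h \<psi>"
    by (simp add: potential_def fun_eq_iff)
  ultimately show ?thesis unfolding sparse_def by simp
qed

section \<open>Replacing a vertex of degree three by an edge\<close>

lemma bit_add_shift: "(a + k) + (b + k) = (a + b :: bit)"
  by (cases a; cases b; cases k; simp)

text \<open>The edges at \<open>v\<close> are oriented away from it, so their heads are the
  neighbours and their gains are read from \<open>v\<close>.\<close>

locale degree_three =
  fixes t h :: "'e \<Rightarrow> 'v::finite" and \<psi> :: "'e \<Rightarrow> bit" and E S :: "'e set" and v :: 'v
  assumes finE: "finite E" and sparse: "sparse t h \<psi> E"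
    and S: "S = {e \<in> E. t e = v \<or> h e = v}" and tS: "\<And>e. e \<in> S \<Longrightarrow> t e = v" and cardS: "card S = 3"
begin

text \<open>
  A block with \<open>m = 2\<close>, or with \<open>m = 3\<close> and a suitable potential, is what forbids adding an edge between
  two of the vertices of \<open>W\<close>.
\<close>
definition block :: "nat \<Rightarrow> 'v set \<Rightarrow> 'e set \<Rightarrow> bool" where
  "block m W F \<longleftrightarrow> F \<subseteq> E - S \<and> t ` F \<union> h ` F \<subseteq> W \<and> v \<notin> W \<and> 2 * card W \<le> card F + m"

lemma S_subset: "S \<subseteq> E"
  unfolding S by blast

lemma finS: "finite S"
  using cardS card_ge_0_finite[of S] by linarith

lemma hS:
  assumes "e \<in> S"
  shows "h e \<noteq> v"
proof -
  have "e \<in> E" using assms S_subset by blast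
  from sparse_no_loop[OF sparse this] tS[OF assms] show ?thesis by metis
qed

lemma blockD:
  assumes "block m W F"
  shows "F \<subseteq> E" "F \<inter> S = {}" "finite F" "\<And>e. e \<in> F \<Longrightarrow> t e \<in> W" "\<And>e. e \<in> F \<Longrightarrow> h e \<in> W"
    "v \<notin> W" "2 * card W \<le> card F + m"
proof -
  have b: "F \<subseteq> E - S" "t ` F \<union> h ` F \<subseteq> W" "v \<notin> W" "2 * card W \<le> card F + m"
    using assms by (simp_all add: block_def)
  show "F \<subseteq> E" "F \<inter> S = {}" using b(1) by blast+
  then show "finite F" using finE finite_subset by blast
  show "t e \<in> W" "h e \<in> W" if "e \<in> F" for e using b(2) that by blast+
  show "v \<notin> W" "2 * card W \<le> card F + m" by (fact b)+
qed

text \<open>Adding \<open>v\<close> with its three edges lowers \<open>2 * card W - card F\<close>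
  by one. A tight set containing all neighbours therefore becomes overfull.\<close>

lemma card_extend:
  assumes "block m W F"
  shows "F \<union> S \<subseteq> E" "card (F \<union> S) = card F + 3" "card (insert v W) = card W + 1"
    "h ` S \<subseteq> W \<Longrightarrow> t ` (F \<union> S) \<union> h ` (F \<union> S) \<subseteq> insert v W"
proof -
  note b = blockD[OF assms]
  show "F \<union> S \<subseteq> E" using b(1) S_subset by blast
  show "card (F \<union> S) = card F + 3" using card_Un_disjoint[OF b(3) finS b(2)] cardS by simp
  show "card (insert v W) = card W + 1" using b(6) by simp
  show "h ` S \<subseteq> W \<Longrightarrow> t ` (F \<union> S) \<union> h ` (F \<union> S) \<subseteq> insert v W"
    using b(4,5) tS by auto
qed

lemma no_block2:
  assumes "block 2 W F" "h ` S \<subseteq> W"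
  shows False
  using sparse_bound[OF sparse card_extend(1)[OF assms(1)] card_extend(4)[OF assms]]
    card_extend(2,3)[OF assms(1)] blockD(7)[OF assms(1)] by simp

lemma no_block3:
  assumes b: "block 3 W F" and "h ` S \<subseteq> W" and \<sigma>: "potential t h \<psi> F \<sigma>" "\<And>e. e \<in> S \<Longrightarrow> \<sigma> (h e) = \<psi> e"
  shows False
proof -
  have "S \<noteq> {}" using cardS by auto
  then have "W \<noteq> {}" using assms(2) by auto
  then have "card W > 0" by (simp add: card_gt_0_iff)
  \<comment> \<open>With value 0 at \<open>v\<close>, the hypothesis
    \<open>\<sigma> (h e) = \<psi> e\<close> is exactly the potential equation on the three new
    edges.\<close>
  have "potential t h \<psi> (F \<union> S) (\<sigma>(v := 0))"
    unfolding potential_def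
  proof
    fix e assume "e \<in> F \<union> S"
    then show "\<psi> e = (\<sigma>(v := 0)) (t e) + (\<sigma>(v := 0)) (h e)"
    proof
      assume e: "e \<in> F"
      then have "t e \<noteq> v" "h e \<noteq> v" using blockD(4-6)[OF b] by blast+
      then show ?thesis using \<sigma>(1) e by (simp add: potential_def)
    next
      assume "e \<in> S"
      then show ?thesis using tS hS \<sigma>(2) by simp
    qed
  qed
  from sparse_bound_potential[OF sparse card_extend(1)[OF b] card_extend(4)[OF b assms(2)] _ this]
  show False using card_extend(2,3)[OF b] blockD(7)[OF b] \<open>card W > 0\<close> by simp
qed

text \<open>Inclusion-exclusion for vertices and edges: if the intersection has slack at least
  \<open>k\<close>, the union has slack at most \<open>m + n - k\<close>. The lemmas below differ in
  the available \<open>k\<close>.\<close>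

lemma block_Un:
  assumes "block m W F" "block n X G" and "card (F \<inter> G) + k \<le> 2 * card (W \<inter> X)" "m + n = l + k"
  shows "block l (W \<union> X) (F \<union> G)"
proof -
  have "card (F \<union> G) + card (F \<inter> G) = card F + card G"
    using card_Un_Int[OF blockD(3)[OF assms(1)] blockD(3)[OF assms(2)]] by simp
  moreover have "card (W \<union> X) + card (W \<inter> X) = card W + card X"
    using card_Un_Int[of W X] by simp
  ultimately have "2 * card (W \<union> X) \<le> card (F \<union> G) + l"
    using assms(3,4) blockD(7)[OF assms(1)] blockD(7)[OF assms(2)] by linarith
  moreover have "F \<union> G \<subseteq> E - S" using blockD(1,2)[OF assms(1)] blockD(1,2)[OF assms(2)] by blast
  moreover have "t ` (F \<union> G) \<union> h ` (F \<union> G) \<subseteq> W \<union> X"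
    using blockD(4,5)[OF assms(1)] blockD(4,5)[OF assms(2)] by auto
  moreover have "v \<notin> W \<union> X" using blockD(6)[OF assms(1)] blockD(6)[OF assms(2)] by blast
  ultimately show ?thesis unfolding block_def by blast
qed

lemma block_Int:
  assumes "block m W F" "block n X G"
  shows "F \<inter> G \<subseteq> E" "t ` (F \<inter> G) \<union> h ` (F \<inter> G) \<subseteq> W \<inter> X"
  using blockD[OF assms(1)] blockD[OF assms(2)] by auto

lemma block_2_2:
  assumes "block 2 W F" "block 2 X G" "W \<inter> X \<noteq> {}"
  shows "block 2 (W \<union> X) (F \<union> G)"
  by (rule block_Un[OF assms(1,2), where k = 2])
    (use sparse_bound[OF sparse block_Int[OF assms(1,2)] assms(3)] in auto)

text \<open>The common edges inherit a potential from \<open>G\<close>, so the strong bound gives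
  slack 3, and 2 + 3 - 3 = 2.\<close>

lemma block_2_3:
  assumes "block 2 W F" "block 3 X G" "potential t h \<psi> G \<sigma>" "card (W \<inter> X) \<ge> 2"
  shows "block 2 (W \<union> X) (F \<union> G)"
  by (rule block_Un[OF assms(1,2), where k = 3])
    (use sparse_bound_potential[OF sparse block_Int[OF assms(1,2)] assms(4), of \<sigma>]
      potential_mono[OF assms(3), of "F \<inter> G"] in auto)

text \<open>
  Two potentials that agree at one but not at all common vertices cut the common edges into two parts,
  each of which satisfies the weak bound.
\<close>
lemma block_3_3_disagree:
  assumes b: "block 3 W F" "block 3 X G" and p: "potential t h \<psi> F \<sigma>" "potential t h \<psi> G \<rho>"
    and x: "x \<in> W \<inter> X" "\<sigma> x = \<rho> x" and y: "y \<in> W \<inter> X" "\<sigma> y \<noteq> \<rho> y"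
  shows "block 2 (W \<union> X) (F \<union> G)"
\<comment> \<open>The two parts contribute slack 2 each, so \<open>k = 4\<close> and the union has
  level 3 + 3 - 4 = 2.\<close>
proof (rule block_Un[OF b, where k = 4])
  let ?A = "{z \<in> W \<inter> X. \<sigma> z = \<rho> z}" and ?B = "{z \<in> W \<inter> X. \<sigma> z \<noteq> \<rho> z}"
  let ?P = "{e \<in> F \<inter> G. \<sigma> (t e) = \<rho> (t e)}" and ?Q = "{e \<in> F \<inter> G. \<sigma> (t e) \<noteq> \<rho> (t e)}"
  \<comment> \<open>Along a common edge both potentials change by the same amount, so no common edge
    joins a vertex of agreement to one of disagreement.\<close>
  have iff: "\<sigma> (t e) = \<rho> (t e) \<longleftrightarrow> \<sigma> (h e) = \<rho> (h e)" if "e \<in> F \<inter> G" for e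
  proof -
    have "\<sigma> (t e) + \<sigma> (h e) = \<rho> (t e) + \<rho> (h e)" using that p by (auto simp: potential_def)
    then show ?thesis by (metis add_left_cancel add_right_cancel)
  qed
  have V: "t e \<in> W \<inter> X" "h e \<in> W \<inter> X" if "e \<in> F \<inter> G" for e
    using block_Int(2)[OF b] that by auto
  have "card ?P + 2 \<le> 2 * card ?A"
  proof (rule sparse_bound[OF sparse])
    show "?P \<subseteq> E" using block_Int(1)[OF b] by blast
    show "t ` ?P \<union> h ` ?P \<subseteq> ?A" using V iff by blast
    show "?A \<noteq> {}" using x by blast
  qed
  moreover have "card ?Q + 2 \<le> 2 * card ?B"
  proof (rule sparse_bound[OF sparse])
    show "?Q \<subseteq> E" using block_Int(1)[OF b] by blast
    show "t ` ?Q \<union> h ` ?Q \<subseteq> ?B" using V iff by blast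
    show "?B \<noteq> {}" using y by blast
  qed
  moreover have "card (F \<inter> G) = card ?P + card ?Q"
  proof -
    have "F \<inter> G = ?P \<union> ?Q" by blast
    moreover have "finite ?P" "finite ?Q"
      by (rule finite_subset[OF _ blockD(3)[OF b(1)]]; blast)+
    then have "card (?P \<union> ?Q) = card ?P + card ?Q" by (rule card_Un_disjoint) blast
    ultimately show ?thesis by metis
  qed
  moreover have "card (W \<inter> X) = card ?A + card ?B"
  proof -
    have "W \<inter> X = ?A \<union> ?B" by blast
    moreover have "card (?A \<union> ?B) = card ?A + card ?B" by (intro card_Un_disjoint) auto
    ultimately show ?thesis by metis
  qed
  ultimately show "card (F \<inter> G) + 4 \<le> 2 * card (W \<inter> X)" by simp
qed simp

lemma potential_Un:
  assumes b: "block m W F" "block n X G" and p: "potential t h \<psi> F \<sigma>" "potential t h \<psi> G \<rho>"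
    and "\<And>z. z \<in> W \<inter> X \<Longrightarrow> \<sigma> z = \<rho> z"
  shows "potential t h \<psi> (F \<union> G) (\<lambda>z. if z \<in> W then \<sigma> z else \<rho> z)"
proof -
  have "\<psi> e = (if t e \<in> W then \<sigma> (t e) else \<rho> (t e)) + (if h e \<in> W then \<sigma> (h e) else \<rho> (h e))"
    if "e \<in> F \<union> G" for e
  proof (cases "e \<in> F")
    case True
    then show ?thesis using blockD(4,5)[OF b(1) True] p(1) by (simp add: potential_def)
  next
    case False
    then have e: "e \<in> G" using that by blast
    then have "(if z \<in> W then \<sigma> z else \<rho> z) = \<rho> z" if "z = t e \<or> z = h e" for z
      using blockD(4,5)[OF b(2) e] assms(5)[of z] that by auto
    then show ?thesis using p(2) e by (simp add: potential_def)
  qed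
  then show ?thesis by (simp add: potential_def)
qed

text \<open>Here 3 + 3 - 3 = 3; \<open>potential_Un\<close> supplies the potential that makes a
  union of this level useful.\<close>

lemma block_3_3_agree:
  assumes b: "block 3 W F" "block 3 X G" and p: "potential t h \<psi> F \<sigma>" "potential t h \<psi> G \<rho>"
    and "\<And>z. z \<in> W \<inter> X \<Longrightarrow> \<sigma> z = \<rho> z" "card (W \<inter> X) \<ge> 2"
  shows "block 3 (W \<union> X) (F \<union> G)"
  by (rule block_Un[OF b, where k = 3])
    (use sparse_bound_potential[OF sparse block_Int[OF b] assms(6), of \<sigma>]
      potential_mono[OF p(1), of "F \<inter> G"] in auto)

text \<open>The obstruction to an edge from \<open>h e\<close> to \<open>h f\<close> with gain
  \<open>\<psi> e + \<psi> f\<close>. A potential is determined only up to a constant on the whole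
  set; it is normalised to match the gains from \<open>v\<close>, so that potentials from different
  pairs agree at a shared neighbour.\<close>

definition blocked :: "'e \<Rightarrow> 'e \<Rightarrow> bool" where
  "blocked e f \<longleftrightarrow> (\<exists>W F. h e \<in> W \<and> h f \<in> W \<and> (block 2 W F \<or>
     (\<exists>\<sigma>. block 3 W F \<and> potential t h \<psi> F \<sigma> \<and> \<sigma> (h e) = \<psi> e \<and> \<sigma> (h f) = \<psi> f)))"

text \<open>The name \<open>e\<close> is reused for the replacement edge, whose gain is that of the
  walk from \<open>h e\<close> through \<open>v\<close> to \<open>h f\<close>. A set violating a
  count must contain it, and deleting it leaves a block.\<close>

lemma unblocked_sparse:
  assumes e: "e \<in> S" "f \<in> S" "h e \<noteq> h f" and nb: "\<not> blocked e f"
  shows "sparse (t(e := h e)) (h(e := h f)) (\<psi>(e := \<psi> e + \<psi> f)) (insert e (E - S))"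
  unfolding sparse_def
proof (intro allI impI, elim conjE)
  fix F' assume F': "F' \<subseteq> insert e (E - S)" "F' \<noteq> {}"
  let ?t = "t(e := h e)" and ?h = "h(e := h f)" and ?\<psi> = "\<psi>(e := \<psi> e + \<psi> f)"
  show "card F' + 2 \<le> 2 * card (?t ` F' \<union> ?h ` F') \<and>
     ((\<exists>\<sigma>. potential ?t ?h ?\<psi> F' \<sigma>) \<longrightarrow> card F' + 3 \<le> 2 * card (?t ` F' \<union> ?h ` F'))"
  proof (cases "e \<in> F'")
    case False
    then have same: "?t x = t x" "?h x = h x" "?\<psi> x = \<psi> x" if "x \<in> F'" for x
      using that by auto
    then have "?t ` F' = t ` F'" "?h ` F' = h ` F'" by (auto intro: image_cong)
    moreover have "potential ?t ?h ?\<psi> F' \<sigma> = potential t h \<psi> F' \<sigma>" for \<sigma>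
      unfolding potential_def by (intro ball_cong refl) (simp only: same)
    moreover have "F' \<subseteq> E" using False F' by auto
    ultimately show ?thesis using sparse[unfolded sparse_def, rule_format, of F'] F'(2) by simp
  next
    case True
    define F where "F = F' - {e}"
    define W where "W = ?t ` F' \<union> ?h ` F'"
    have F: "F' = insert e F" "e \<notin> F" "F \<subseteq> E - S" using True F' e by (auto simp: F_def)
    then have c: "card F' = card F + 1" using finite_subset[of F E] finE by (simp add: subset_iff)
    have W: "W = t ` F \<union> h ` F \<union> {h e, h f}" using F by (auto simp: W_def)
    have sub: "F \<subseteq> E - S \<and> t ` F \<union> h ` F \<subseteq> W \<and> v \<notin> W"
      using F(3) hS[OF e(1)] hS[OF e(2)] unfolding W S by auto
    have "card F' + 2 \<le> 2 * card W"
    proof (rule ccontr)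
      assume "\<not> ?thesis"
      then have "block 2 W F" using sub c by (simp add: block_def)
      moreover have "h e \<in> W" "h f \<in> W" using W by auto
      ultimately show False using nb unfolding blocked_def by metis
    qed
    moreover have "card F' + 3 \<le> 2 * card W" if p: "potential ?t ?h ?\<psi> F' \<sigma>" for \<sigma>
    proof (rule ccontr)
      assume "\<not> ?thesis"
      then have b: "block 3 W F" using sub c by (simp add: block_def)
      \<comment> \<open>The constant that moves the value of the potential at \<open>h e\<close> to
        \<open>\<psi> e\<close>; the equation on the new edge then gives \<open>\<psi> f\<close> at
        \<open>h f\<close>.\<close>
      define k where "k = \<sigma> (h e) + \<psi> e"
      have "potential t h \<psi> F (\<lambda>z. \<sigma> z + k)"
        unfolding potential_def
      proof
        fix x assume x: "x \<in> F"
        then have "x \<noteq> e" using F(2) by blast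
        then have "\<psi> x = \<sigma> (t x) + \<sigma> (h x)"
          using p[unfolded potential_def, rule_format, of x] x F(1) by simp
        then show "\<psi> x = \<sigma> (t x) + k + (\<sigma> (h x) + k)" by (simp only: bit_add_shift)
      qed
      moreover have "\<psi> e + \<psi> f = \<sigma> (h e) + \<sigma> (h f)"
        using p True unfolding potential_def by fastforce
      then have "\<sigma> (h f) + k = \<psi> f" unfolding k_def
        by (cases "\<psi> e"; cases "\<psi> f"; cases "\<sigma> (h e)"; cases "\<sigma> (h f)"; simp)
      moreover have "\<sigma> (h e) + k = \<psi> e"
        unfolding k_def using bit_add_self(2)[of "\<sigma> (h e)" "\<psi> e"] by simp
      moreover have "h e \<in> W" "h f \<in> W" using W by auto
      ultimately show False using nb b unfolding blocked_def by metis
    qed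
    ultimately show ?thesis unfolding W_def by metis
  qed
qed

section \<open>The obstructions at the three pairs of edges exclude one another\<close>

text \<open>The union contains all neighbours of \<open>v\<close>. Two blocks of level 2, or a
  second common vertex, would let the obstructions merge into a block ruled out by
  \<open>no_block2\<close> or \<open>no_block3\<close>.\<close>

lemma two_blocks_meet:
  assumes S3: "S = {e, f, g}"
    and W: "h e \<in> W" "h f \<in> W" "block 2 W F \<or>
      (block 3 W F \<and> potential t h \<psi> F \<sigma> \<and> \<sigma> (h e) = \<psi> e \<and> \<sigma> (h f) = \<psi> f)"
    and X: "h f \<in> X" "h g \<in> X" "block 2 X G \<or>
      (block 3 X G \<and> potential t h \<psi> G \<rho> \<and> \<rho> (h f) = \<psi> f \<and> \<rho> (h g) = \<psi> g)"
  shows "W \<inter> X = {h f} \<and> (block 3 W F \<or> block 3 X G)"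
proof -
  have hS': "h ` S \<subseteq> W \<union> X" using S3 W X by auto
  have no2: "\<not> block 2 (W \<union> X) (F \<union> G)" using no_block2 hS' by blast
  have f: "h f \<in> W \<inter> X" using W X by blast
  then have ne: "W \<inter> X \<noteq> {}" by blast
  have n22: "\<not> (block 2 W F \<and> block 2 X G)" using no2 block_2_2 ne by blast
  have "card (W \<inter> X) < 2"
  proof (rule ccontr)
    assume "\<not> ?thesis"
    then have c: "card (W \<inter> X) \<ge> 2" by simp
    consider "block 2 W F" "block 3 X G" "potential t h \<psi> G \<rho>"
      | "block 2 X G" "block 3 W F" "potential t h \<psi> F \<sigma>"
      | "block 3 W F" "potential t h \<psi> F \<sigma>" "\<sigma> (h e) = \<psi> e" "\<sigma> (h f) = \<psi> f"
        "block 3 X G" "potential t h \<psi> G \<rho>" "\<rho> (h f) = \<psi> f" "\<rho> (h g) = \<psi> g"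
      using W(3) X(3) n22 by blast
    then show False
    proof cases
      case 1
      then show False using no2 block_2_3 c by blast
    next
      case 2
      then have "block 2 (X \<union> W) (G \<union> F)" using c by (intro block_2_3[where \<sigma> = \<sigma>]) (simp_all add: Int_commute)
      then show False using no2 by (simp add: Un_commute)
    next
      case 3
      \<comment> \<open>Both potentials equal \<open>\<psi> f\<close> at \<open>h f\<close>, so any
        disagreement elsewhere would produce a forbidden block of level 2.\<close>
      have agree: "\<sigma> z = \<rho> z" if "z \<in> W \<inter> X" for z
      proof (rule ccontr)
        assume "\<sigma> z \<noteq> \<rho> z"
        moreover have "\<sigma> (h f) = \<rho> (h f)" using 3 by simp
        ultimately show False
          using block_3_3_disagree[OF 3(1,5,2,6) f _ that] no2 by blast
      qed
      have b: "block 3 (W \<union> X) (F \<union> G)" by (rule block_3_3_agree[OF 3(1,5,2,6) agree c])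
      have val: "(if h x \<in> W then \<sigma> (h x) else \<rho> (h x)) = \<psi> x" if x: "x \<in> S" for x
      proof -
        consider "x = e" | "x = f" | "x = g" using S3 x by auto
        then show ?thesis
        proof cases
          case g: 3
          show ?thesis
          proof (cases "h g \<in> W")
            case True
            then have "\<sigma> (h g) = \<rho> (h g)" using agree X(2) by blast
            then show ?thesis using g 3 by simp
          qed (use g 3 in simp)
        qed (use W 3 in simp_all)
      qed
      show False
        by (rule no_block3[OF b hS' potential_Un[OF 3(1,5,2,6) agree] val])
    qed
  qed
  moreover have "card (W \<inter> X) \<noteq> 0" using ne by simp
  ultimately have "card (W \<inter> X) = 1" by linarith
  then have "W \<inter> X = {h f}" using f by (metis card_1_singletonE singletonD)
  then show ?thesis using n22 W(3) X(3) by blast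
qed

text \<open>On a single vertex the weak bound reads
  \<open>card (F \<inter> G) + 2 \<le> 2\<close>.\<close>

lemma block_disjoint:
  assumes "block m W F" "block n X G" "W \<inter> X = {x}"
  shows "F \<inter> G = {}"
  using sparse_bound[OF sparse block_Int[OF assms(1,2)]] blockD(3)[OF assms(1)] assms(3) by simp

text \<open>The blocks form a triangle with corners \<open>h e\<close>, \<open>h f\<close>,
  \<open>h g\<close>. Each corner is counted twice, so three vertices are lost in the union and the
  levels add up minus 6.\<close>

lemma three_blocks:
  assumes S3: "S = {e, f, g}" and d: "h e \<noteq> h f" "h f \<noteq> h g" "h e \<noteq> h g"
    and b: "block k W F" "block l X G" "block m Y K"
    and i: "W \<inter> X = {h f}" "X \<inter> Y = {h g}" "W \<inter> Y = {h e}"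
  shows "block (k + l + m - 6) (W \<union> X \<union> Y) (F \<union> G \<union> K)" "h ` S \<subseteq> W \<union> X \<union> Y"
proof -
  have "F \<inter> G = {}" "G \<inter> K = {}" "F \<inter> K = {}" using block_disjoint b i by blast+
  then have c: "card (F \<union> G \<union> K) = card F + card G + card K"
    using blockD(3)[OF b(1)] blockD(3)[OF b(2)] blockD(3)[OF b(3)]
    by (simp add: card_Un_disjoint Int_Un_distrib2)
  have "(W \<union> X) \<inter> Y = {h e, h g}" using i by blast
  then have "card (W \<union> X \<union> Y) + 2 = card (W \<union> X) + card Y"
    using card_Un_Int[of "W \<union> X" Y] d by simp
  moreover have "card (W \<union> X) + 1 = card W + card X"
    using card_Un_Int[of W X] i by simp
  ultimately have cW: "card (W \<union> X \<union> Y) + 3 = card W + card X + card Y" by linarith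
  have "F \<union> G \<union> K \<subseteq> E - S" 
    using blockD(1,2)[OF b(1)] blockD(1,2)[OF b(2)] blockD(1,2)[OF b(3)] by blast
  moreover have "t ` (F \<union> G \<union> K) \<union> h ` (F \<union> G \<union> K) \<subseteq> W \<union> X \<union> Y"
    using blockD(4,5)[OF b(1)] blockD(4,5)[OF b(2)] blockD(4,5)[OF b(3)] by auto
  moreover have "v \<notin> W \<union> X \<union> Y"
    using blockD(6)[OF b(1)] blockD(6)[OF b(2)] blockD(6)[OF b(3)] by blast
  moreover have "2 * card (W \<union> X \<union> Y) \<le> card (F \<union> G \<union> K) + (k + l + m - 6)"
    using c cW blockD(7)[OF b(1)] blockD(7)[OF b(2)] blockD(7)[OF b(3)] by linarith
  ultimately show "block (k + l + m - 6) (W \<union> X \<union> Y) (F \<union> G \<union> K)"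
    unfolding block_def by blast
  have "h e \<in> W" "h f \<in> W" "h g \<in> X" using i by blast+
  then show "h ` S \<subseteq> W \<union> X \<union> Y" using S3 by auto
qed

lemma block_mono: "block m W F \<Longrightarrow> m \<le> n \<Longrightarrow> block n W F"
  by (auto simp: block_def)

text \<open>One block of level 2 in the triangle would give 2 + 3 + 3 - 6 = 2. Otherwise all levels
  are 3, the potentials agree at the corners and glue, and 3 + 3 + 3 - 6 = 3 contradicts
  \<open>no_block3\<close>.\<close>

lemma distinct_heads_not_all_blocked:
  assumes S3: "S = {e, f, g}" and d: "h e \<noteq> h f" "h f \<noteq> h g" "h e \<noteq> h g"
    and bl: "blocked e f" "blocked f g" "blocked g e"
  shows False
proof -
  obtain W F \<sigma> where W: "h e \<in> W" "h f \<in> W" "block 2 W F \<or>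
      (block 3 W F \<and> potential t h \<psi> F \<sigma> \<and> \<sigma> (h e) = \<psi> e \<and> \<sigma> (h f) = \<psi> f)"
    using bl(1) unfolding blocked_def by metis
  obtain X G \<rho> where X: "h f \<in> X" "h g \<in> X" "block 2 X G \<or>
      (block 3 X G \<and> potential t h \<psi> G \<rho> \<and> \<rho> (h f) = \<psi> f \<and> \<rho> (h g) = \<psi> g)"
    using bl(2) unfolding blocked_def by metis
  obtain Y K \<pi> where Y: "h g \<in> Y" "h e \<in> Y" "block 2 Y K \<or>
      (block 3 Y K \<and> potential t h \<psi> K \<pi> \<and> \<pi> (h g) = \<psi> g \<and> \<pi> (h e) = \<psi> e)"
    using bl(3) unfolding blocked_def by metis
  have S3': "S = {f, g, e}" "S = {g, e, f}" using S3 by auto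
  note m1 = two_blocks_meet[OF S3 W X] and m2 = two_blocks_meet[OF S3'(1) X Y]
    and m3 = two_blocks_meet[OF S3'(2) Y W]
  have i: "W \<inter> X = {h f}" "X \<inter> Y = {h g}" "W \<inter> Y = {h e}" using m1 m2 m3 by (simp_all add: Int_commute)
  note three = three_blocks[OF S3 d _ _ _ i]
  have b3: "block 3 W F" "block 3 X G" "block 3 Y K"
    using W(3) X(3) Y(3) block_mono[of 2 _ _ 3] by auto
  have no: "\<not> block 2 W F" "\<not> block 2 X G" "\<not> block 2 Y K"
    using three(1)[of 2 F 3 G 3 K] three(1)[of 3 F 2 G 3 K] three(1)[of 3 F 3 G 2 K]
      b3 no_block2[OF _ three(2)[OF b3]] by auto
  then have p: "potential t h \<psi> F \<sigma>" "potential t h \<psi> G \<rho>" "potential t h \<psi> K \<pi>"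
    and v: "\<sigma> (h e) = \<psi> e" "\<sigma> (h f) = \<psi> f" "\<rho> (h f) = \<psi> f" "\<rho> (h g) = \<psi> g"
      "\<pi> (h g) = \<psi> g" "\<pi> (h e) = \<psi> e"
    using W(3) X(3) Y(3) by blast+
  let ?q = "\<lambda>z. if z \<in> W then \<sigma> z else \<rho> z"
  have pq: "potential t h \<psi> (F \<union> G) ?q"
    by (rule potential_Un[OF b3(1,2) p(1,2)]) (use i v in simp)
  \<comment> \<open>Level 6 is enough here: gluing potentials only uses that the edges of a block
    have their ends in its vertex set.\<close>
  have WX: "block 6 (W \<union> X) (F \<union> G)"
    by (rule block_Un[OF b3(1,2), where k = 0]) (simp_all add: block_disjoint[OF b3(1,2) i(1)])
  have "h g \<notin> W \<inter> Y" using i(3) d by simp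
  then have hgW: "h g \<notin> W" using Y(1) by simp
  have "?q z = \<pi> z" if "z \<in> (W \<union> X) \<inter> Y" for z
  proof -
    have "z = h e \<or> z = h g" using that i by blast
    then show ?thesis using W(1) v hgW by auto
  qed
  from potential_Un[OF WX b3(3) pq p(3) this]
  have "potential t h \<psi> (F \<union> G \<union> K) (\<lambda>z. if z \<in> W \<union> X then ?q z else \<pi> z)" .
  moreover have "block 3 (W \<union> X \<union> Y) (F \<union> G \<union> K)" using three(1)[OF b3] by simp
  moreover have "(if h x \<in> W \<union> X then ?q (h x) else \<pi> (h x)) = \<psi> x" if "x \<in> S" for x
    using that S3 W(1,2) X(2) v hgW by auto
  ultimately show False using no_block3[OF _ three(2)[OF b3]] by blast
qed

text \<open>Each block already contains all neighbours, so neither has level 2. Their potentials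
  agree at \<open>h g\<close> but differ at the shared head of \<open>e\<close> and
  \<open>f\<close>, which yields level 2 for the union.\<close>

lemma repeated_head_not_all_blocked:
  assumes S3: "S = {e, f, g}" and d: "h e = h f" "\<psi> e \<noteq> \<psi> f"
    and bl: "blocked e g" "blocked f g"
  shows False
proof -
  obtain W F \<sigma> where W: "h e \<in> W" "h g \<in> W" "block 2 W F \<or>
      (block 3 W F \<and> potential t h \<psi> F \<sigma> \<and> \<sigma> (h e) = \<psi> e \<and> \<sigma> (h g) = \<psi> g)"
    using bl(1) unfolding blocked_def by metis
  obtain X G \<rho> where X: "h f \<in> X" "h g \<in> X" "block 2 X G \<or>
      (block 3 X G \<and> potential t h \<psi> G \<rho> \<and> \<rho> (h f) = \<psi> f \<and> \<rho> (h g) = \<psi> g)"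
    using bl(2) unfolding blocked_def by metis
  have sub: "h ` S \<subseteq> W" "h ` S \<subseteq> X" "h ` S \<subseteq> W \<union> X" using W X S3 d by auto
  have 3: "block 3 W F" "block 3 X G" "potential t h \<psi> F \<sigma>" "potential t h \<psi> G \<rho>"
    and v: "\<sigma> (h e) = \<psi> e" "\<sigma> (h g) = \<psi> g" "\<rho> (h f) = \<psi> f" "\<rho> (h g) = \<psi> g"
    using W(3) X(3) no_block2 sub by blast+
  have "block 2 (W \<union> X) (F \<union> G)"
    by (rule block_3_3_disagree[OF 3, where x = "h g" and y = "h e"]) (use W X v d in auto)
  then show False using no_block2 sub(3) by blast
qed

text \<open>Equal heads are excluded since the new edge would be a loop. Parallel edges at
  \<open>v\<close> carry different gains, and there are only two gains, so the three heads do not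
  all coincide; the two preceding lemmas treat the remaining cases.\<close>

lemma exists_unblocked:
  "\<exists>e f g. S = {e, f, g} \<and> e \<noteq> f \<and> f \<noteq> g \<and> e \<noteq> g \<and> h e \<noteq> h f \<and> \<not> blocked e f"
proof (rule ccontr)
  assume "\<not> ?thesis"
  then have A: "blocked e f" if "S = {e, f, g}" "e \<noteq> f" "f \<noteq> g" "e \<noteq> g" "h e \<noteq> h f" for e f g
    using that by blast
  obtain e f g where S3: "S = {e, f, g}" "e \<noteq> f" "f \<noteq> g" "e \<noteq> g"
    using cardS by (auto simp: card_3_iff)
  have par: "\<psi> x \<noteq> \<psi> y" if "x \<in> S" "y \<in> S" "x \<noteq> y" "h x = h y" for x y
    using sparse_no_parallel[OF sparse] that tS S_subset by (metis subsetD)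
  have rep: False if "S = {x, y, z}" "x \<noteq> y" "y \<noteq> z" "x \<noteq> z" "h x = h y" for x y z
  proof -
    have "h x \<noteq> h z"
    proof
      assume "h x = h z"
      then have "\<psi> x \<noteq> \<psi> y" "\<psi> y \<noteq> \<psi> z" "\<psi> x \<noteq> \<psi> z" using par that by auto
      then show False by (cases "\<psi> x"; cases "\<psi> y"; cases "\<psi> z"; simp)
    qed
    moreover have "S = {x, z, y}" "S = {y, z, x}" using that by auto
    ultimately have "blocked x z" "blocked y z" using A that by metis+
    then show False using repeated_head_not_all_blocked[OF that(1,5)] par that by blast
  qed
  have p: "S = {f, g, e}" "S = {g, e, f}" "S = {e, g, f}" using S3 by auto
  have d: "h e \<noteq> h f" "h f \<noteq> h g" "h e \<noteq> h g"
    using rep[OF S3] rep[OF p(1)] rep[OF p(3)] S3 by auto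
  show False
    by (rule distinct_heads_not_all_blocked[OF S3(1) d]) (use A S3 p d in metis)+
qed

end

section \<open>Realising sparse gain graphs\<close>

definition sg :: "bit \<Rightarrow> real" where
  "sg b = (if b = 0 then 1 else - 1)"

lemma sg_simps [simp]: "sg 0 = 1" "sg 1 = - 1" "sg b * sg b = 1" "sg b \<noteq> 0" "sg (a + b) = sg a * sg b"
  by (cases a; cases b; simp add: sg_def)+

lemma axis_scaleR: "axis u (c *\<^sub>R z) = c *\<^sub>R axis u (z :: 'a::real_vector)"
  by (auto simp: vec_eq_iff axis_def)

text \<open>Placements are vectors rather than functions so that they form a real vector space, in
  which lines of placements make sense.\<close>

definition edge_dir ::
  "('e \<Rightarrow> 'v) \<Rightarrow> ('e \<Rightarrow> 'v) \<Rightarrow> ('e \<Rightarrow> bit) \<Rightarrow> real^2^'v::finite \<Rightarrow> 'e \<Rightarrow> real^2" where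
  "edge_dir t h \<psi> p e = p $ t e - sg (\<psi> e) *\<^sub>R p $ h e"

definition edge_row ::
  "('e \<Rightarrow> 'v) \<Rightarrow> ('e \<Rightarrow> 'v) \<Rightarrow> ('e \<Rightarrow> bit) \<Rightarrow> real^2^'v::finite \<Rightarrow> 'e \<Rightarrow> real^2^'v" where
  "edge_row t h \<psi> p e = axis (t e) (edge_dir t h \<psi> p e) - axis (h e) (edge_dir t h \<psi> p e)"

lemma edge_row_nth: "edge_row t h \<psi> p e $ w =
    (if w = t e then edge_dir t h \<psi> p e else 0) - (if w = h e then edge_dir t h \<psi> p e else 0)"
  by (simp add: edge_row_def axis_def)

lemma linear_edge_row: "linear (\<lambda>p. edge_row t h \<psi> p e)"
  by (rule linearI) (simp_all add: vec_eq_iff edge_row_nth edge_dir_def algebra_simps)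

lemma row_independent_scale:
  fixes M N :: "'e \<Rightarrow> 'a::euclidean_space"
  assumes "finite E" "row_independent E M" "\<And>e. e \<in> E \<Longrightarrow> k e \<noteq> 0 \<and> N e = k e *\<^sub>R M e"
  shows "row_independent E N"
proof (rule row_independentI[OF assms(1)])
  fix c e assume s: "(\<Sum>e\<in>E. c e *\<^sub>R N e) = 0" and e: "e \<in> E"
  have "(\<Sum>e\<in>E. (c e * k e) *\<^sub>R M e) = (\<Sum>e\<in>E. c e *\<^sub>R N e)"
    using assms(3) by (intro sum.cong) auto
  then have "c e * k e = 0" using row_independentD[OF assms(2,1) _ e, of "\<lambda>e. c e * k e"] s by simp
  then show "c e = 0" using assms(3)[OF e] by simp
qed

text \<open>Reversing an edge multiplies its row by the sign of its gain.\<close>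

lemma row_independent_reorient:
  assumes "finite E" and "\<And>e. (t' e = t e \<and> h' e = h e) \<or> (t' e = h e \<and> h' e = t e)"
    and "row_independent E (edge_row t h \<psi> p)"
  shows "row_independent E (edge_row t' h' \<psi> p)"
proof (rule row_independent_scale[OF assms(1,3)])
  fix e
  let ?k = "if t' e = t e \<and> h' e = h e then 1 else sg (\<psi> e)"
  show "?k \<noteq> 0 \<and> edge_row t' h' \<psi> p e = ?k *\<^sub>R edge_row t h \<psi> p e"
  proof (cases "t' e = t e \<and> h' e = h e")
    case True
    then show ?thesis by (simp add: edge_row_def edge_dir_def)
  next
    case False
    then have "t' e = h e" "h' e = t e" using assms(2)[of e] by auto
    moreover have "edge_dir t' h' \<psi> p e = - sg (\<psi> e) *\<^sub>R edge_dir t h \<psi> p e"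
      by (simp add: calculation edge_dir_def scaleR_diff_right)
    ultimately show ?thesis using False
      by (simp add: edge_row_def axis_scaleR[symmetric] scaleR_diff_right)
        (simp add: vec_eq_iff axis_def)
  qed
qed

lemma row_independent_pair:
  fixes M :: "'e \<Rightarrow> 'a::euclidean_space"
  assumes "a \<noteq> b"
  shows "row_independent {a, b} M \<longleftrightarrow> (\<forall>\<alpha> \<beta>. \<alpha> *\<^sub>R M a + \<beta> *\<^sub>R M b = 0 \<longrightarrow> \<alpha> = 0 \<and> \<beta> = 0)"
proof -
  have "(\<forall>c. P (c a) (c b)) \<longleftrightarrow> (\<forall>\<alpha> \<beta>. P \<alpha> \<beta>)" for P :: "real \<Rightarrow> real \<Rightarrow> bool"
  proof
    assume A: "\<forall>c. P (c a) (c b)"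
    show "\<forall>\<alpha> \<beta>. P \<alpha> \<beta>"
    proof (intro allI)
      fix \<alpha> \<beta> show "P \<alpha> \<beta>" using A[rule_format, of "\<lambda>x. if x = a then \<alpha> else \<beta>"] assms by simp
    qed
  qed simp
  from this[of "\<lambda>\<alpha> \<beta>. \<alpha> *\<^sub>R M a + \<beta> *\<^sub>R M b = 0 \<longrightarrow> \<alpha> = 0 \<and> \<beta> = 0"]
  show ?thesis using assms by (simp add: row_independent_iff)
qed

lemma row_independent_single:
  fixes M :: "'e \<Rightarrow> 'a::euclidean_space"
  shows "row_independent {a} M \<longleftrightarrow> M a \<noteq> 0"
  by (simp add: row_independent_def)

text \<open>Seen from \<open>t e\<close>, the edge \<open>e\<close> leads to the point \<open>edge_target h \<psi> p e\<close> of the covering framework.\<close>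
definition edge_target :: "('e \<Rightarrow> 'v) \<Rightarrow> ('e \<Rightarrow> bit) \<Rightarrow> real^2^'v::finite \<Rightarrow> 'e \<Rightarrow> real^2" where
  "edge_target h \<psi> p e = sg (\<psi> e) *\<^sub>R p $ h e"

lemma linear_edge_target_diff: "linear (\<lambda>p. edge_target h \<psi> p e - edge_target h \<psi> p f)"
  by (rule linearI) (simp_all add: edge_target_def algebra_simps)

section \<open>Extending a placement to a new vertex\<close>

definition place :: "real^2^'v::finite \<Rightarrow> 'v \<Rightarrow> real^2 \<Rightarrow> real^2^'v" where
  "place p v x = (\<chi> w. if w = v then x else p $ w)"

locale vertex_star =
  fixes t h :: "'e \<Rightarrow> 'v::finite" and \<psi> :: "'e \<Rightarrow> bit" and E S :: "'e set" and v :: 'v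
  assumes finE: "finite E" and S: "S = {e \<in> E. t e = v \<or> h e = v}"
    and tS: "\<And>e. e \<in> S \<Longrightarrow> t e = v" and hS: "\<And>e. e \<in> S \<Longrightarrow> h e \<noteq> v"
begin

lemma S_subset: "S \<subseteq> E"
  unfolding S by blast

lemma finS: "finite S"
  using finite_subset[OF S_subset finE] .

lemma not_S: "e \<in> E - S \<Longrightarrow> t e \<noteq> v" "e \<in> E - S \<Longrightarrow> h e \<noteq> v"
  unfolding S by blast+

lemma edge_row_place:
  assumes "e \<in> E - S"
  shows "edge_row t h \<psi> (place p v x) e = edge_row t h \<psi> p e"
  using not_S[OF assms] by (simp add: edge_row_def edge_dir_def place_def)

lemma edge_dir_place:
  assumes "e \<in> S"
  shows "edge_dir t h \<psi> (place p v x) e = x - edge_target h \<psi> p e"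
  using tS[OF assms] hS[OF assms] by (simp add: edge_dir_def edge_target_def place_def)

text \<open>Only the edges at \<open>v\<close> have entries in the columns of \<open>v\<close>, so a
  dependency splits off an equilibrium condition there; the other rows do not see the position of
  \<open>v\<close>.\<close>

lemma dependency_at_center:
  assumes "(\<Sum>e\<in>E. c e *\<^sub>R edge_row t h \<psi> (place p v x) e) = 0"
  shows "(\<Sum>e\<in>S. c e *\<^sub>R (x - edge_target h \<psi> p e)) = 0"
    "(\<Sum>e\<in>E - S. c e *\<^sub>R edge_row t h \<psi> p e) + (\<Sum>e\<in>S. c e *\<^sub>R edge_row t h \<psi> (place p v x) e) = 0"
proof -
  note split = sum.subset_diff[OF S_subset finE]
  have "(\<Sum>e\<in>E - S. c e *\<^sub>R edge_row t h \<psi> (place p v x) e) = (\<Sum>e\<in>E - S. c e *\<^sub>R edge_row t h \<psi> p e)"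
    by (intro sum.cong refl) (simp only: edge_row_place)
  then show "(\<Sum>e\<in>E - S. c e *\<^sub>R edge_row t h \<psi> p e) + (\<Sum>e\<in>S. c e *\<^sub>R edge_row t h \<psi> (place p v x) e) = 0"
    using assms by (simp add: split)
  have "0 = (\<Sum>e\<in>E. c e *\<^sub>R edge_row t h \<psi> (place p v x) e) $ v" using assms by simp
  also have "\<dots> = (\<Sum>e\<in>E. c e *\<^sub>R (edge_row t h \<psi> (place p v x) e $ v))" by simp
  also have "\<dots> = (\<Sum>e\<in>E - S. c e *\<^sub>R (edge_row t h \<psi> (place p v x) e $ v)) +
      (\<Sum>e\<in>S. c e *\<^sub>R (edge_row t h \<psi> (place p v x) e $ v))" by (rule split)
  also have "(\<Sum>e\<in>E - S. c e *\<^sub>R (edge_row t h \<psi> (place p v x) e $ v)) = 0"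
    by (intro sum.neutral ballI) (simp add: edge_row_nth not_S[THEN not_sym])
  also have "(\<Sum>e\<in>S. c e *\<^sub>R (edge_row t h \<psi> (place p v x) e $ v)) = (\<Sum>e\<in>S. c e *\<^sub>R (x - edge_target h \<psi> p e))"
    by (intro sum.cong refl) (simp add: edge_row_nth edge_dir_place tS hS[THEN not_sym])
  finally show "(\<Sum>e\<in>S. c e *\<^sub>R (x - edge_target h \<psi> p e)) = 0" by simp
qed

text \<open>The equilibrium at \<open>v\<close> forces the coefficients of its edges to vanish,
  which leaves a dependency of the old rows.\<close>

lemma zero_extension:
  assumes p: "row_independent (E - S) (edge_row t h \<psi> p)"
    and x: "row_independent S (\<lambda>e. x - edge_target h \<psi> p e)"
  shows "row_independent E (edge_row t h \<psi> (place p v x))"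
proof (rule row_independentI[OF finE])
  fix c e assume s: "(\<Sum>e\<in>E. c e *\<^sub>R edge_row t h \<psi> (place p v x) e) = 0" and e: "e \<in> E"
  have cS: "c e = 0" if "e \<in> S" for e
    by (rule row_independentD[OF x finS dependency_at_center(1)[OF s] that])
  then have "(\<Sum>e\<in>E - S. c e *\<^sub>R edge_row t h \<psi> p e) = 0"
    using dependency_at_center(2)[OF s] by simp
  then have "c e = 0" if "e \<in> E - S" for e
    using row_independentD[OF p] finE that by blast
  then show "c e = 0" using cS e by blast
qed

text \<open>
  The new vertex is placed at the midpoint of the line through the targets of \<open>e\<close> and \<open>f\<close>: equal
  multiples of the rows of \<open>e\<close> and \<open>f\<close> then add up to a multiple of the row of the edge that they replace.
\<close>
lemma one_extension:
  assumes S3: "S = {e, f, g}" and d: "e \<noteq> f" "f \<noteq> g" "e \<noteq> g"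
    and p: "row_independent (insert e (E - S))
      (edge_row (t(e := h e)) (h(e := h f)) (\<psi>(e := \<psi> e + \<psi> f)) p)"
    and ind: "row_independent {f, g} (\<lambda>x. edge_target h \<psi> p e - edge_target h \<psi> p x)"
  shows "row_independent E (edge_row t h \<psi>
    (place p v ((1/2) *\<^sub>R (edge_target h \<psi> p e + edge_target h \<psi> p f))))"
proof (rule row_independentI[OF finE])
  let ?q = "edge_target h \<psi> p"
  let ?x = "(1/2) *\<^sub>R (?q e + ?q f)"
  let ?row = "edge_row (t(e := h e)) (h(e := h f)) (\<psi>(e := \<psi> e + \<psi> f)) p"
  let ?R = "edge_row t h \<psi> (place p v ?x)"
  fix c a assume s: "(\<Sum>x\<in>E. c x *\<^sub>R ?R x) = 0" and a: "a \<in> E"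
  have "c e *\<^sub>R (?x - ?q e) + c f *\<^sub>R (?x - ?q f) + c g *\<^sub>R (?x - ?q g) = 0"
    using dependency_at_center(1)[OF s] S3 d by (simp add: add.assoc)
  \<comment> \<open>From the midpoint, the targets of \<open>e\<close> and \<open>f\<close> lie at
    opposite displacements, so everything is expressed in the two independent vectors of
    \<open>ind\<close>.\<close>
  also have "c e *\<^sub>R (?x - ?q e) + c f *\<^sub>R (?x - ?q f) + c g *\<^sub>R (?x - ?q g) =
      ((c f - c e - c g) / 2) *\<^sub>R (?q e - ?q f) + c g *\<^sub>R (?q e - ?q g)"
    by (simp add: vec_eq_iff field_simps)
  finally have "(c f - c e - c g) / 2 = 0 \<and> c g = 0"
    using ind[unfolded row_independent_pair[OF d(2)]] by blast
  then have c: "c g = 0" "c f = c e" by auto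
  let ?d = "(1/2) *\<^sub>R (?q e - ?q f)"
  have eS: "e \<in> S" "f \<in> S" using S3 by auto
  have "edge_dir t h \<psi> (place p v ?x) e = - ?d" "edge_dir t h \<psi> (place p v ?x) f = ?d"
    by (simp_all add: edge_dir_place[OF eS(1)] edge_dir_place[OF eS(2)] vec_eq_iff field_simps)
  then have "?R e + ?R f = axis (h e) ?d - axis (h f) ?d"
    using tS eS unfolding edge_row_def by (simp add: vec_eq_iff axis_def)
  moreover have "edge_dir (t(e := h e)) (h(e := h f)) (\<psi>(e := \<psi> e + \<psi> f)) p e = (2 * sg (\<psi> e)) *\<^sub>R ?d"
    unfolding edge_dir_def edge_target_def fun_upd_same sg_simps(5)
    by (simp add: scaleR_diff_right mult.assoc[symmetric])
  then have "?row e = (2 * sg (\<psi> e)) *\<^sub>R (axis (h e) ?d - axis (h f) ?d)"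
    unfolding edge_row_def fun_upd_same by (simp only: axis_scaleR scaleR_diff_right[symmetric])
  then have "axis (h e) ?d - axis (h f) ?d = (sg (\<psi> e) / 2) *\<^sub>R ?row e" by simp
  ultimately have Rs: "c e *\<^sub>R ?R e + c f *\<^sub>R ?R f = (c e * sg (\<psi> e) / 2) *\<^sub>R ?row e"
    using c(2) by (simp add: scaleR_add_right[symmetric])
  have old: "?row x = edge_row t h \<psi> p x" if "x \<noteq> e" for x
    using that by (simp add: edge_row_def edge_dir_def)
  \<comment> \<open>The common coefficient of \<open>e\<close> and \<open>f\<close> is transferred
    to the row of the replacement edge.\<close>
  define b where "b = c(e := c e * sg (\<psi> e) / 2)"
  have "(\<Sum>x\<in>E - S. b x *\<^sub>R ?row x) = (\<Sum>x\<in>E - S. c x *\<^sub>R edge_row t h \<psi> p x)"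
    using old eS by (intro sum.cong refl) (auto simp: b_def)
  moreover have "(\<Sum>x\<in>insert e (E - S). b x *\<^sub>R ?row x) = b e *\<^sub>R ?row e + (\<Sum>x\<in>E - S. b x *\<^sub>R ?row x)"
    using eS finE by (intro sum.insert) auto
  moreover have "(\<Sum>x\<in>S. c x *\<^sub>R ?R x) = b e *\<^sub>R ?row e"
    using S3 d c Rs by (simp add: add.assoc b_def)
  ultimately have "(\<Sum>x\<in>insert e (E - S). b x *\<^sub>R ?row x) = 0"
    using dependency_at_center(2)[OF s] by (simp add: add.commute)
  from row_independentD[OF p _ this] have b0: "b x = 0" if "x \<in> insert e (E - S)" for x
    using finE that by blast
  then have "c e = 0" using b0[of e] by (simp add: b_def)
  moreover have "c x = 0" if "x \<in> E - S" for x
    using b0[of x] that eS by (auto simp: b_def split: if_splits)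
  moreover have "a \<in> E - S \<or> a = e \<or> a = f \<or> a = g" using a S3 by auto
  ultimately show "c a = 0" using c by metis
qed

end

text \<open>Two neighbours are put at the standard basis vectors and all others at the origin. If
  \<open>g\<close> shares its head with \<open>e\<close> or \<open>f\<close>, the different gain
  makes its target the opposite point.\<close>

lemma exists_generic_targets:
  fixes h :: "'e \<Rightarrow> 'v::finite"
  assumes "h e \<noteq> h f" "f \<noteq> g" and "h g = h e \<Longrightarrow> \<psi> g \<noteq> \<psi> e" "h g = h f \<Longrightarrow> \<psi> g \<noteq> \<psi> f"
  shows "\<exists>p. row_independent {f, g} (\<lambda>x. edge_target h \<psi> p e - edge_target h \<psi> p x)"
proof (cases "h g = h e \<or> h g = h f")
  case True
  let ?p = "axis (h e) (axis 1 1) + axis (h f) (axis 2 1) :: real^2^'v"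
  have "row_independent {f, g} (\<lambda>x. edge_target h \<psi> ?p e - edge_target h \<psi> ?p x)"
    unfolding row_independent_pair[OF assms(2)] using True assms
    by (cases "\<psi> e"; cases "\<psi> f"; cases "\<psi> g"; auto simp: edge_target_def vec_eq_iff forall_2 axis_def)
  then show ?thesis by blast
next
  case False
  let ?p = "axis (h f) (axis 1 1) + axis (h g) (axis 2 1) :: real^2^'v"
  have "row_independent {f, g} (\<lambda>x. edge_target h \<psi> ?p e - edge_target h \<psi> ?p x)"
    unfolding row_independent_pair[OF assms(2)] using False assms
    by (cases "\<psi> e"; cases "\<psi> f"; cases "\<psi> g"; auto simp: edge_target_def vec_eq_iff forall_2 axis_def)
  then show ?thesis by blast
qed

lemma exists_distinct_targets:
  fixes h :: "'e \<Rightarrow> 'v::finite"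
  assumes "h e = h f \<Longrightarrow> \<psi> e \<noteq> \<psi> f"
  shows "\<exists>p. edge_target h \<psi> p e - edge_target h \<psi> p f \<noteq> 0"
proof
  show "edge_target h \<psi> (axis (h e) (axis 1 1)) e - edge_target h \<psi> (axis (h e) (axis 1 1)) f \<noteq> 0"
    using assms
    by (cases "\<psi> e"; cases "\<psi> f"; auto simp: edge_target_def vec_eq_iff forall_2 axis_def)
qed

lemma exists_point_off_line:
  fixes a b :: "real^2"
  assumes "a \<noteq> b"
  shows "\<exists>x. \<forall>\<alpha> \<beta>. \<alpha> *\<^sub>R (x - a) + \<beta> *\<^sub>R (x - b) = 0 \<longrightarrow> \<alpha> = 0 \<and> \<beta> = 0"
proof (intro exI allI impI)
  let ?z = "b - a"
  \<comment> \<open>The vector \<open>b - a\<close> is turned by a right angle and attached at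
    \<open>a\<close>. The resulting linear system in \<open>\<alpha> + \<beta>\<close> and
    \<open>\<beta>\<close> has the squared length of \<open>b - a\<close> as determinant.\<close>
  let ?x = "a + vector [- ?z $ 2, ?z $ 1]"
  fix \<alpha> \<beta> :: real
  assume "\<alpha> *\<^sub>R (?x - a) + \<beta> *\<^sub>R (?x - b) = 0"
  then have *: "- (\<alpha> + \<beta>) * ?z $ 2 - \<beta> * ?z $ 1 = 0" "(\<alpha> + \<beta>) * ?z $ 1 - \<beta> * ?z $ 2 = 0"
    by (simp_all add: vec_eq_iff forall_2 vector_2 algebra_simps)
  have nz: "(?z $ 1)\<^sup>2 + (?z $ 2)\<^sup>2 \<noteq> 0"
    using assms by (auto simp: vec_eq_iff forall_2 sum_power2_eq_zero_iff)
  have "\<beta> * ((?z $ 1)\<^sup>2 + (?z $ 2)\<^sup>2) = 0" using * by algebra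
  moreover have "(\<alpha> + \<beta>) * ((?z $ 1)\<^sup>2 + (?z $ 2)\<^sup>2) = 0" using * by algebra
  ultimately have "\<beta> = 0" "\<alpha> + \<beta> = 0" using nz by (metis mult_eq_0_iff)+
  then show "\<alpha> = 0 \<and> \<beta> = 0" by simp
qed

text \<open>Induction on the number of edges. End maps and gains stay arbitrary because the step at
  degree three redirects an edge; at lower degree the star is simply removed and restored.\<close>

theorem sparse_realizable:
  fixes t h :: "'e \<Rightarrow> 'v::finite"
  assumes "finite E" "sparse t h \<psi> E"
  shows "\<exists>p. row_independent E (edge_row t h \<psi> p)"
  using assms
proof (induction "card E" arbitrary: t h \<psi> E rule: less_induct)
  case less
  show ?case
  proof (cases "E = {}")
    case True
    then show ?thesis by (simp add: row_independent_def independent_empty)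
  next
    case False
    obtain v where v: "{e \<in> E. t e = v \<or> h e = v} \<noteq> {}" "card {e \<in> E. t e = v \<or> h e = v} \<le> 3"
      using sparse_low_degree[OF less.prems(2,1) False] by blast
    \<comment> \<open>Edges at \<open>v\<close> are turned to start there;
      \<open>row_independent_reorient\<close> undoes this at the end.\<close>
    define t' where "t' e = (if h e = v then v else t e)" for e
    define h' where "h' e = (if h e = v then t e else h e)" for e
    define S where "S = {e \<in> E. t' e = v \<or> h' e = v}"
    have or1: "(t' e = t e \<and> h' e = h e) \<or> (t' e = h e \<and> h' e = t e)" for e
      by (simp add: t'_def h'_def)
    then have or2: "(t e = t' e \<and> h e = h' e) \<or> (t e = h' e \<and> h e = t' e)" for e
      by metis
    have sp: "sparse t' h' \<psi> E" using less.prems(2) sparse_reorient[of t' t h' h, OF or1] by simp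
    have "S = {e \<in> E. t e = v \<or> h e = v}" unfolding S_def t'_def h'_def by auto
    then have Sne: "S \<noteq> {}" and Sle: "card S \<le> 3" using v by simp_all
    have SE: "S \<subseteq> E" unfolding S_def by blast
    have tS: "t' e = v" if "e \<in> S" for e using that by (auto simp: S_def t'_def h'_def)
    have hS: "h' e \<noteq> v" if "e \<in> S" for e
      using sparse_no_loop[OF sp, of e] tS[OF that] SE that by auto
    interpret vertex_star t' h' \<psi> E S v
      by (rule vertex_star.intro[OF less.prems(1) S_def tS hS])
    have par: "\<psi> x \<noteq> \<psi> y" if "x \<in> S" "y \<in> S" "x \<noteq> y" "h' x = h' y" for x y
      using sparse_no_parallel[OF sp] that tS SE by (metis subsetD)
    have "\<exists>p. row_independent E (edge_row t' h' \<psi> p)"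
    proof (cases "card S = 3")
      case False
      have "card (E - S) < card E"
        by (rule psubset_card_mono[OF less.prems(1)]) (use Sne SE in blast)
      then obtain p where p: "row_independent (E - S) (edge_row t' h' \<psi> p)"
        using less.hyps[of "E - S" t' h' \<psi>] less.prems(1) sparse_mono[OF sp, of "E - S"] by auto
      have "card S \<noteq> 0" using Sne finS by (metis card_0_eq)
      then consider "card S = 1" | "card S = 2" using False Sle by linarith
      then show ?thesis
      proof cases
        case 1
        then obtain e where e: "S = {e}" using card_1_singletonE by blast
        have "row_independent S (\<lambda>x. (edge_target h' \<psi> p e + axis 1 1) - edge_target h' \<psi> p x)"
          unfolding e row_independent_single by (simp add: axis_eq_0_iff)
        from zero_extension[OF p this] show ?thesis by blast
      next
        case 2
        then obtain e f where e: "S = {e, f}" "e \<noteq> f" by (auto simp: card_2_iff)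
        then have "h' e = h' f \<Longrightarrow> \<psi> e \<noteq> \<psi> f" using par by auto
        then obtain p0 where "edge_target h' \<psi> p0 e - edge_target h' \<psi> p0 f \<noteq> 0"
          using exists_distinct_targets[of h' e f \<psi>] by blast
        \<comment> \<open>Distinctness of the two targets, phrased as independence of a one-element
          family, so that it can be combined with the independence of the old rows.\<close>
        then have "row_independent {f} (\<lambda>x. edge_target h' \<psi> p0 e - edge_target h' \<psi> p0 x)"
          unfolding row_independent_single .
        from common_row_independent_parameter[OF _ _ linear_edge_row linear_edge_target_diff p this]
        obtain p1 where p1: "row_independent (E - S) (edge_row t' h' \<psi> p1)"
          and "row_independent {f} (\<lambda>x. edge_target h' \<psi> p1 e - edge_target h' \<psi> p1 x)"
          using less.prems(1) by auto
        then have "edge_target h' \<psi> p1 e \<noteq> edge_target h' \<psi> p1 f"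
          unfolding row_independent_single by simp
        from exists_point_off_line[OF this] obtain x
          where "row_independent S (\<lambda>a. x - edge_target h' \<psi> p1 a)"
          unfolding e(1) row_independent_pair[OF e(2)] by blast
        from zero_extension[OF p1 this] show ?thesis by blast
      qed
    next
      case True
      interpret degree_three t' h' \<psi> E S v
        by (rule degree_three.intro[OF less.prems(1) sp S_def tS True])
      obtain e f g where S3: "S = {e, f, g}" and d: "e \<noteq> f" "f \<noteq> g" "e \<noteq> g"
        and ef: "h' e \<noteq> h' f" "\<not> blocked e f" using exists_unblocked by blast
      have eS: "e \<in> S" "f \<in> S" "g \<in> S" using S3 by auto
      let ?t = "t'(e := h' e)" and ?h = "h'(e := h' f)" and ?\<psi> = "\<psi>(e := \<psi> e + \<psi> f)"
      have "insert e (E - S) \<subseteq> E" "f \<notin> insert e (E - S)" "f \<in> E" using eS SE d(1) by auto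
      then have "insert e (E - S) \<subset> E" by blast
      then have "card (insert e (E - S)) < card E" using less.prems(1) by (intro psubset_card_mono)
      then obtain p where p: "row_independent (insert e (E - S)) (edge_row ?t ?h ?\<psi> p)"
        using less.hyps[of "insert e (E - S)" ?t ?h ?\<psi>] less.prems(1) unblocked_sparse[OF eS(1,2) ef]
        by auto
      obtain p0 where p0: "row_independent {f, g} (\<lambda>x. edge_target h' \<psi> p0 e - edge_target h' \<psi> p0 x)"
        using exists_generic_targets[OF ef(1) d(2), of \<psi>] par eS d by metis
      \<comment> \<open>\<open>p\<close> need not have generic targets and \<open>p0\<close> need
        not make the rows independent; \<open>p1\<close> does both.\<close>
      from common_row_independent_parameter[OF _ _ linear_edge_row linear_edge_target_diff p p0]
      obtain p1 where p1: "row_independent (insert e (E - S)) (edge_row ?t ?h ?\<psi> p1)"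
        "row_independent {f, g} (\<lambda>x. edge_target h' \<psi> p1 e - edge_target h' \<psi> p1 x)"
        using less.prems(1) by (metis finite.emptyI finite_Diff finite_insert)
      from one_extension[OF S3 d p1] show ?thesis by blast
    qed
    then show ?thesis using row_independent_reorient[of E t t' h h', OF less.prems(1) or2] by blast
  qed
qed

section \<open>Necessity of the counts\<close>

text \<open>The second family lies in the orthogonal complement of the first within
  \<open>U\<close>, and the two dimensions add up to that of \<open>U\<close>.\<close>

lemma card_add_card_le_dim:
  fixes M :: "'e \<Rightarrow> 'a::euclidean_space" and N :: "'i \<Rightarrow> 'a"
  assumes "row_independent F M" "row_independent I N" "subspace U" "M ` F \<subseteq> U" "N ` I \<subseteq> U"
    and orth: "\<And>e i. e \<in> F \<Longrightarrow> i \<in> I \<Longrightarrow> M e \<bullet> N i = 0"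
  shows "card F + card I \<le> dim U"
proof -
  let ?A = "span (M ` F)" and ?C = "{y \<in> U. \<forall>x\<in>span (M ` F). orthogonal x y}"
  have "N i \<in> ?C" if "i \<in> I" for i
  proof -
    have "orthogonal (N i) x" if x: "x \<in> ?A" for x
      by (rule orthogonal_to_span[OF x]) (use orth that \<open>i \<in> I\<close> in \<open>auto simp: orthogonal_def inner_commute\<close>)
    then show ?thesis using assms(5) that by (auto simp: orthogonal_commute)
  qed
  then have "card (N ` I) \<le> dim ?C"
    using assms(2) by (intro independent_card_le_dim) (auto simp: row_independent_def)
  moreover have "dim ?A = card (M ` F)"
    using assms(1) by (simp add: row_independent_def dim_eq_card_independent)
  moreover have "dim ?C + dim ?A = dim U"
    using assms(3,4) by (intro dim_subspace_orthogonal_to_vectors) (auto intro: span_minimal[THEN subsetD])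
  ultimately show ?thesis
    using assms(1,2) by (simp add: row_independent_def card_image)
qed

lemma dim_supported_le:
  fixes W :: "'v::finite set"
  shows "dim {x :: real^2^'v. \<forall>w. w \<notin> W \<longrightarrow> x $ w = 0} \<le> 2 * card W"
proof -
  let ?B = "(\<lambda>(w, i). axis w (axis i 1) :: real^2^'v) ` (W \<times> UNIV)"
  have "{x :: real^2^'v. \<forall>w. w \<notin> W \<longrightarrow> x $ w = 0} \<subseteq> span ?B"
  proof
    fix x :: "real^2^'v" assume x: "x \<in> {x. \<forall>w. w \<notin> W \<longrightarrow> x $ w = 0}"
    have "x = (\<Sum>w\<in>W. \<Sum>i\<in>UNIV. (x $ w $ i) *\<^sub>R axis w (axis i 1))"
    proof (subst vec_eq_iff, intro allI, subst vec_eq_iff, intro allI)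
      fix v :: 'v and j :: 2
      have "((x $ w $ i) *\<^sub>R axis w (axis i 1 :: real^2)) $ v $ j =
          (if i = j then if w = v then x $ w $ j else 0 else 0)" for w i
        by (auto simp: axis_def)
      then have "(\<Sum>w\<in>W. \<Sum>i\<in>UNIV. (x $ w $ i) *\<^sub>R axis w (axis i 1)) $ v $ j =
          (\<Sum>w\<in>W. if w = v then x $ w $ j else 0)"
        by (simp only: sum_component) simp
      also have "\<dots> = x $ v $ j" using x by simp
      finally show "x $ v $ j = (\<Sum>w\<in>W. \<Sum>i\<in>UNIV. (x $ w $ i) *\<^sub>R axis w (axis i 1)) $ v $ j" ..
    qed
    also have "\<dots> \<in> span ?B"
      by (intro span_sum span_scale span_base) auto
    finally show "x \<in> span ?B" .
  qed
  then have "dim {x :: real^2^'v. \<forall>w. w \<notin> W \<longrightarrow> x $ w = 0} \<le> card ?B"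
    by (rule dim_le_card) simp
  also have "\<dots> \<le> card (W \<times> (UNIV :: 2 set))" by (rule card_image_le) simp
  finally show ?thesis by (simp add: card_cartesian_product)
qed

lemma sparse_if_row_independent:
  fixes t h :: "'e \<Rightarrow> 'v::finite"
  assumes "finite E" "row_independent E (edge_row t h \<psi> p)"
  shows "sparse t h \<psi> E"
  unfolding sparse_def
proof (intro allI impI, elim conjE)
  fix F assume F: "F \<subseteq> E" "F \<noteq> {}"
  have finF: "finite F" using finite_subset F(1) assms(1) by blast
  have ind: "row_independent F (edge_row t h \<psi> p)" using row_independent_mono[OF assms(2) F(1)] .
  define W where "W = t ` F \<union> h ` F"
  have W: "t e \<in> W" "h e \<in> W" if "e \<in> F" for e using that by (auto simp: W_def)
  obtain e0 where e0: "e0 \<in> F" using F(2) by blast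
  \<comment> \<open>A nondegenerate edge is what later separates the rotation from the
    translations.\<close>
  have d0: "edge_dir t h \<psi> p e0 \<noteq> 0"
  proof
    assume "edge_dir t h \<psi> p e0 = 0"
    then have "edge_row t h \<psi> p e0 = 0" by (simp add: vec_eq_iff edge_row_nth)
    then show False using ind e0 by (metis dependent_zero image_eqI row_independent_def)
  qed
  let ?U = "{x :: real^2^'v. \<forall>w. w \<notin> W \<longrightarrow> x $ w = 0}"
  have U: "subspace ?U" by (auto simp: subspace_def)
  have MU: "edge_row t h \<psi> p ` F \<subseteq> ?U" using W by (auto simp: edge_row_nth)
  \<comment> \<open>Indices 0 and 1 are the translations, index 2 is the infinitesimal rotation of
    the placement switched by \<open>\<sigma>\<close>. All are cut off outside \<open>W\<close> to
    lie in a space of dimension at most \<open>2 * card W\<close>.\<close>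
  define N :: "('v \<Rightarrow> bit) \<Rightarrow> nat \<Rightarrow> real^2^'v" where "N \<sigma> i = (\<chi> w. if w \<in> W then (if i = 0 then vector [1, 0] else if i = 1 then vector [0, 1]
      else sg (\<sigma> w) *\<^sub>R vector [- p $ w $ 2, p $ w $ 1]) else 0)" for \<sigma> i
  have NU: "N \<sigma> ` I \<subseteq> ?U" for \<sigma> I by (auto simp: N_def)
  have inner: "edge_row t h \<psi> p e \<bullet> x = edge_dir t h \<psi> p e \<bullet> (x $ t e - x $ h e)" for e x
    by (simp add: edge_row_def inner_diff_left inner_diff_right inner_axis')
  have orth01: "edge_row t h \<psi> p e \<bullet> N \<sigma> i = 0" if "e \<in> F" "i \<in> {0, 1}" for e i \<sigma>
    using that W[OF that(1)] by (auto simp: inner N_def)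
  obtain w0 where w0: "w0 \<in> W" using W[OF e0] by blast
  have ind01: "row_independent {0, 1} (N \<sigma>)" for \<sigma>
  proof -
    have "\<alpha> = 0 \<and> \<beta> = 0" if "\<alpha> *\<^sub>R N \<sigma> 0 + \<beta> *\<^sub>R N \<sigma> 1 = 0" for \<alpha> \<beta>
    proof -
      have "(\<alpha> *\<^sub>R N \<sigma> 0 + \<beta> *\<^sub>R N \<sigma> 1) $ w0 = 0" using that by simp
      then show ?thesis using w0 by (simp add: N_def vec_eq_iff forall_2 vector_2)
    qed
    then show ?thesis by (subst row_independent_pair) auto
  qed
  have "card F + card {0, 1 :: nat} \<le> dim ?U"
    by (rule card_add_card_le_dim[OF ind ind01 U MU NU orth01])
  then have b2: "card F + 2 \<le> 2 * card W" using dim_supported_le[of W] by simp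
  have b3: "card F + 3 \<le> 2 * card W" if \<sigma>: "potential t h \<psi> F \<sigma>" for \<sigma>
  proof -
    have s: "sg (\<psi> e) = sg (\<sigma> (t e)) * sg (\<sigma> (h e))" if "e \<in> F" for e
      using \<sigma> that by (metis potential_def sg_simps(5))
    \<comment> \<open>After switching, the edge direction is a signed difference of two points and
      the rotation turns this difference by a right angle.\<close>
    have orth2: "edge_row t h \<psi> p e \<bullet> N \<sigma> 2 = 0" if e: "e \<in> F" for e
    proof -
      have N2: "N \<sigma> 2 $ w = sg (\<sigma> w) *\<^sub>R vector [- p $ w $ 2, p $ w $ 1]" if "w \<in> W" for w
        using that by (simp add: N_def)
      have inner2: "x \<bullet> y = x $ 1 * y $ 1 + x $ 2 * y $ 2" for x y :: "real^2"
        by (simp add: inner_vec_def sum_2)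
      have sq: "sg (\<sigma> (t e)) * sg (\<sigma> (t e)) = 1" "sg (\<sigma> (h e)) * sg (\<sigma> (h e)) = 1" by simp_all
      show ?thesis
        unfolding inner N2[OF W(1)[OF e]] N2[OF W(2)[OF e]] inner2 edge_dir_def s[OF e]
        by (simp add: vector_2) (use sq in algebra)
    qed
    have ind2: "row_independent {0, 1, 2} (N \<sigma>)"
    proof (rule row_independentI)
      fix c :: "nat \<Rightarrow> real" and i :: nat
      assume c: "(\<Sum>i\<in>{0, 1, 2}. c i *\<^sub>R N \<sigma> i) = 0" and i: "i \<in> {0, 1, 2}"
      have eq: "c 0 = c 2 * sg (\<sigma> w) * p $ w $ 2" "c 1 = - c 2 * sg (\<sigma> w) * p $ w $ 1" if w: "w \<in> W" for w
      proof -
        have "(\<Sum>i\<in>{0, 1, 2}. c i *\<^sub>R N \<sigma> i) $ w = 0" using c by simp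
        then show "c 0 = c 2 * sg (\<sigma> w) * p $ w $ 2" "c 1 = - c 2 * sg (\<sigma> w) * p $ w $ 1"
          using w by (simp_all add: N_def vec_eq_iff forall_2 vector_2)
      qed
      \<comment> \<open>Were the rotation a combination of translations, all switched points would
        coincide and \<open>e0\<close> would have direction 0.\<close>
      have "c 2 = 0"
      proof (rule ccontr)
        assume c2: "c 2 \<noteq> 0"
        let ?u = "t e0" and ?v = "h e0"
        have k: "sg (\<sigma> ?u) * p $ ?u $ j = sg (\<sigma> ?v) * p $ ?v $ j" for j
          using eq[OF W(1)[OF e0]] eq[OF W(2)[OF e0]] c2 exhaust_2[of j] by auto
        have "p $ ?u $ j = sg (\<psi> e0) * p $ ?v $ j" for j
        proof -
          have "p $ ?u $ j = sg (\<sigma> ?u) * (sg (\<sigma> ?u) * p $ ?u $ j)"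
            by (simp add: mult.assoc[symmetric])
          then show ?thesis unfolding k s[OF e0] by (simp add: mult.assoc)
        qed
        then have "edge_dir t h \<psi> p e0 = 0" by (simp add: edge_dir_def vec_eq_iff)
        then show False using d0 by blast
      qed
      then show "c i = 0" using eq[OF w0] i by auto
    qed simp
    have "card F + card {0, 1, 2 :: nat} \<le> dim ?U"
      by (rule card_add_card_le_dim[OF ind ind2 U MU NU]) (use orth01 orth2 in auto)
    then show ?thesis using dim_supported_le[of W] by simp
  qed
  show "card F + 2 \<le> 2 * card (t ` F \<union> h ` F) \<and>
     ((\<exists>\<sigma>. potential t h \<psi> F \<sigma>) \<longrightarrow> card F + 3 \<le> 2 * card (t ` F \<union> h ` F))"
    using b2 b3 unfolding W_def by blast
qed

section \<open>The rank of the covering framework\<close>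

definition symmetric_row ::
  "('e \<Rightarrow> 'v) \<Rightarrow> ('e \<Rightarrow> 'v) \<Rightarrow> ('e \<Rightarrow> bit) \<Rightarrow> real^2^'v::finite \<Rightarrow> 'e \<Rightarrow> real^2^'v" where
  "symmetric_row t h \<psi> p e =
     axis (t e) (edge_dir t h \<psi> p e) - axis (h e) (sg (\<psi> e) *\<^sub>R edge_dir t h \<psi> p e)"

lemma symmetric_row_nth: "symmetric_row t h \<psi> p e $ w =
    (if w = t e then edge_dir t h \<psi> p e else 0) - (if w = h e then sg (\<psi> e) *\<^sub>R edge_dir t h \<psi> p e else 0)"
  by (simp add: symmetric_row_def axis_def)

lemma linear_symmetric_row: "linear (\<lambda>p. symmetric_row t h \<psi> p e)"
  by (rule linearI) (simp_all add: vec_eq_iff symmetric_row_nth edge_dir_def algebra_simps)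

text \<open>The half-turn acts on the plane as \<open>- 1\<close>: a symmetric vector changes sign
  between the two copies of a vertex, while an antisymmetric one takes equal values on them.\<close>

definition lift_symmetric :: "real^2^'v::finite \<Rightarrow> real^2^(bit \<times> 'v)" where
  "lift_symmetric x = (\<chi> a. sg (fst a) *\<^sub>R x $ snd a)"

definition lift_antisymmetric :: "real^2^'v::finite \<Rightarrow> real^2^(bit \<times> 'v)" where
  "lift_antisymmetric x = (\<chi> a. x $ snd a)"

lemma linear_lift_symmetric: "linear lift_symmetric"
  by (rule linearI) (simp_all add: lift_symmetric_def vec_eq_iff algebra_simps)

lemma linear_lift_antisymmetric: "linear lift_antisymmetric"
  by (rule linearI) (simp_all add: lift_antisymmetric_def vec_eq_iff)

lemma lift_eq_iff: "lift_symmetric x = lift_antisymmetric y \<longleftrightarrow> x = 0 \<and> y = 0"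
proof
  assume "lift_symmetric x = lift_antisymmetric y"
  then have "sg g * x $ w $ i = y $ w $ i" for g w i
    by (auto simp: lift_symmetric_def lift_antisymmetric_def vec_eq_iff)
  from this[of 0] this[of 1] have "x $ w $ i = y $ w $ i" "- (x $ w $ i) = y $ w $ i" for w i by auto
  then have "x $ w $ i = 0" "y $ w $ i = 0" for w i
    by (metis equal_neg_zero)+
  then show "x = 0 \<and> y = 0" by (simp add: vec_eq_iff)
qed (auto simp: lift_symmetric_def lift_antisymmetric_def vec_eq_iff)

lemma inj_lift: "inj lift_symmetric" "inj lift_antisymmetric"
proof -
  show "inj lift_antisymmetric"
    by (auto simp: inj_def lift_antisymmetric_def vec_eq_iff)
  show "inj lift_symmetric"
    by (rule injI) (auto simp: lift_symmetric_def vec_eq_iff)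
qed

lemma rigidity_matrix_row_commute: "rigidity_matrix_row P u v = rigidity_matrix_row P v u"
  by (simp add: rigidity_matrix_row_def add.commute)

context
  fixes \<tau> :: "bit \<Rightarrow> real^2^2"
  assumes faithful: "faithful_representation \<tau> half_turn_group"
begin

text \<open>\<open>\<tau> 0\<close> is idempotent, which excludes \<open>- mat 1\<close>, and
  faithfulness leaves only \<open>- mat 1\<close> for \<open>\<tau> 1\<close>.\<close>

lemma representation_eq: "\<tau> b = sg b *\<^sub>R mat 1"
proof -
  have mem: "\<tau> g = mat 1 \<or> \<tau> g = - mat 1" for g
    using faithful by (auto simp: faithful_representation_def half_turn_group_def)
  have mult: "\<tau> (g + h) = \<tau> g ** \<tau> h" for g h
    using faithful by (auto simp: faithful_representation_def)
  have neg: "(- mat 1) ** (- mat 1 :: real^2^2) = mat 1"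
    by (simp add: vec_eq_iff forall_2 matrix_matrix_mult_def sum_2 mat_def)
  have "\<tau> 0 = mat 1" using mem[of 0] mult[of 0 0] neg by auto
  moreover have "\<tau> 1 \<noteq> \<tau> 0" using faithful by (auto simp: faithful_representation_def inj_def)
  ultimately show ?thesis using mem[of 1] by (cases b) auto
qed

lemma representation_vector [simp]: "\<tau> b *v x = sg b *\<^sub>R x"
  by (simp add: representation_eq scaleR_matrix_vector_assoc[symmetric])

lemma representation_inverse_vector [simp]: "matrix_inv (\<tau> b) *v x = sg b *\<^sub>R x"
proof -
  have "\<tau> (b + b) = \<tau> b ** \<tau> b"
    using faithful unfolding faithful_representation_def by blast
  then have sq: "\<tau> b ** \<tau> b = mat 1"
    unfolding bit_add_self(1) representation_eq[of 0] by simp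
  then have "\<exists>B. \<tau> b ** B = mat 1 \<and> B ** \<tau> b = mat 1" by blast
  then have "\<tau> b ** matrix_inv (\<tau> b) = mat 1"
    unfolding matrix_inv_def by (rule someI2_ex) simp
  then have "matrix_inv (\<tau> b) = \<tau> b" using sq by (metis matrix_mul_assoc matrix_mul_lid matrix_mul_rid)
  then show ?thesis by simp
qed

lemma orbit_matrix_row_eq:
  "orbit_matrix_row H \<tau> \<psi> q e = edge_row (tail H) (head H) \<psi> (vec_lambda q) e"
proof -
  have "(if \<psi> e = 0 then 1 else - 1 :: real) = sg (\<psi> e)" by (simp add: sg_def)
  then show ?thesis
    by (simp add: orbit_matrix_row_def Let_def edge_row_def edge_dir_def scaleR_diff_right)
      (simp add: vec_eq_iff axis_def)
qed

text \<open>At copy \<open>k\<close> of the tail of a non-loop, the right-hand side carries the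
  factor \<open>(sg k + sg g) / 2\<close>, which vanishes unless \<open>k = g\<close>; the head is
  similar with \<open>g + \<psi> e\<close>.\<close>

lemma covering_row:
  "rigidity_matrix_row (symmetric_lift \<tau> q) (g, tail H e) (g + \<psi> e, head H e) =
    (1/2) *\<^sub>R (lift_symmetric (symmetric_row (tail H) (head H) \<psi> (vec_lambda q) e) +
      sg g *\<^sub>R lift_antisymmetric (edge_row (tail H) (head H) \<psi> (vec_lambda q) e))"
  (is "?L = ?R")
proof -
  have "?L $ (k, w) = ?R $ (k, w)" for k w
    by (cases g; cases k; cases "\<psi> e"; cases "w = tail H e"; cases "w = head H e")
      (auto simp: rigidity_matrix_row_def symmetric_lift_def lift_symmetric_def lift_antisymmetric_def
        symmetric_row_nth edge_row_nth edge_dir_def axis_def vec_eq_iff)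
  then show ?thesis by (metis surj_pair vec_eq_iff)
qed

text \<open>Sum and difference of the rows of the two copies of an edge are its lifted symmetric and
  antisymmetric rows. The row space is thus the direct sum of two injectively lifted row
  spaces.\<close>

lemma rigidity_rank_covering:
  "rigidity_rank (covering_edges H \<psi>) (symmetric_lift \<tau> q) =
    dim (symmetric_row (tail H) (head H) \<psi> (vec_lambda q) ` arcs H) +
    dim (edge_row (tail H) (head H) \<psi> (vec_lambda q) ` arcs H)"
proof -
  let ?P = "symmetric_lift \<tau> q"
  let ?s = "symmetric_row (tail H) (head H) \<psi> (vec_lambda q)"
    and ?a = "edge_row (tail H) (head H) \<psi> (vec_lambda q)"
  let ?A = "?s ` arcs H" and ?B = "?a ` arcs H"
  let ?LA = "lift_symmetric ` ?A" and ?LB = "lift_antisymmetric ` ?B"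
  define R where "R g e = rigidity_matrix_row ?P (g, tail H e) (g + \<psi> e, head H e)" for g e
  let ?R = "{rigidity_matrix_row ?P u v | u v. {u, v} \<in> covering_edges H \<psi>}"
  have R_set: "?R = {R g e | g e. e \<in> arcs H}"
  proof (intro equalityI subsetI)
    fix x assume "x \<in> ?R"
    then obtain u v g e where "x = rigidity_matrix_row ?P u v" "e \<in> arcs H"
      "{u, v} = {(g, tail H e), (g + \<psi> e, head H e)}" by (auto simp: covering_edges_def)
    then have "x = R g e"
      unfolding R_def doubleton_eq_iff using rigidity_matrix_row_commute by metis
    then show "x \<in> {R g e | g e. e \<in> arcs H}" using \<open>e \<in> arcs H\<close> by blast
  next
    fix x assume "x \<in> {R g e | g e. e \<in> arcs H}"
    then show "x \<in> ?R" unfolding R_def covering_edges_def by blast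
  qed
  have R_eq: "R g e = (1/2) *\<^sub>R (lift_symmetric (?s e) + sg g *\<^sub>R lift_antisymmetric (?a e))" for g e
    unfolding R_def by (rule covering_row)
  have "span ?R = span (?LA \<union> ?LB)"
    unfolding R_set span_eq
  proof (intro conjI subsetI)
    fix x assume "x \<in> {R g e | g e. e \<in> arcs H}"
    then show "x \<in> span (?LA \<union> ?LB)"
      by (auto simp: R_eq intro!: span_scale span_add intro: span_base)
  next
    fix x assume x: "x \<in> ?LA \<union> ?LB"
    have "R g e \<in> span {R g e | g e. e \<in> arcs H}" if "e \<in> arcs H" for g e
      using that by (intro span_base) blast
    moreover have "lift_symmetric (?s e) = R 0 e + R 1 e" "lift_antisymmetric (?a e) = R 0 e - R 1 e" for e
      by (simp_all add: R_eq vec_eq_iff field_simps)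
    moreover obtain e where "e \<in> arcs H" "x = lift_symmetric (?s e) \<or> x = lift_antisymmetric (?a e)"
      using x by blast
    ultimately show "x \<in> span {R g e | g e. e \<in> arcs H}"
      by (metis (no_types, lifting) span_add span_diff)
  qed
  then have "dim (span ?R) = dim (span (?LA \<union> ?LB))" by simp
  then have "dim ?R = dim (span (?LA \<union> ?LB))" by (simp only: dim_span)
  also have "\<dots> = dim {x + y | x y. x \<in> span ?LA \<and> y \<in> span ?LB} + dim (span ?LA \<inter> span ?LB)"
  proof -
    have "span ?LA \<inter> span ?LB \<subseteq> {0}"
    proof
      fix z assume z: "z \<in> span ?LA \<inter> span ?LB"
      then obtain x y where "z = lift_symmetric x" "z = lift_antisymmetric y"
        unfolding linear_span_image[OF linear_lift_symmetric] linear_span_image[OF linear_lift_antisymmetric]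
        by blast
      then have "y = 0" "z = lift_antisymmetric y" using lift_eq_iff[of x y] by auto
      then show "z \<in> {0}" by (simp add: lift_antisymmetric_def vec_eq_iff)
    qed
    then have "dim (span ?LA \<inter> span ?LB) = 0" by (metis dim_eq_0)
    then show ?thesis by (simp add: span_Un)
  qed
  also have "\<dots> = dim ?LA + dim ?LB"
    by (subst dim_sums_Int) simp_all
  also have "dim ?LA = dim ?A"
    by (intro dim_image_eq linear_lift_symmetric inj_on_subset[OF inj_lift(1)]) simp
  also have "dim ?LB = dim ?B"
    by (intro dim_image_eq linear_lift_antisymmetric inj_on_subset[OF inj_lift(2)]) simp
  finally show ?thesis unfolding rigidity_rank_def .
qed

end

section \<open>Ranks of row families and the equivalence\<close>

lemma row_independent_basis:
  fixes M :: "'e \<Rightarrow> 'a::euclidean_space"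
  shows "\<exists>B\<subseteq>E. row_independent B M \<and> card B = dim (M ` E)"
proof -
  obtain C where C: "C \<subseteq> M ` E" "independent C" "card C = dim (M ` E)"
    by (rule basis_exists)
  then obtain B where "B \<subseteq> E" "inj_on M B" "C = M ` B" by (auto simp: subset_image_inj)
  then show ?thesis using C by (intro exI[of _ B]) (auto simp: row_independent_def card_image)
qed

lemma row_independent_card_le_dim:
  fixes M :: "'e \<Rightarrow> 'a::euclidean_space"
  assumes "row_independent B M" "B \<subseteq> E"
  shows "card B \<le> dim (M ` E)"
proof -
  have "card (M ` B) \<le> dim (M ` E)"
    using assms by (intro independent_card_le_dim) (auto simp: row_independent_def)
  then show ?thesis using assms(1) by (simp add: row_independent_def card_image)
qed

lemma row_independent_if_card_le_dim:
  fixes M :: "'e \<Rightarrow> 'a::euclidean_space"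
  assumes "finite E" "card E \<le> dim (M ` E)"
  shows "row_independent E M"
proof -
  have "dim (M ` E) \<le> card (M ` E)" using assms(1) by (intro dim_le_card') simp
  moreover have "card (M ` E) \<le> card E" using assms(1) by (rule card_image_le)
  ultimately have c: "card (M ` E) = card E" "card (M ` E) \<le> dim (M ` E)" using assms(2) by simp_all
  have "independent (M ` E)"
    by (rule card_le_dim_spanning[of _ "M ` E"]) (use c assms(1) in \<open>auto intro: span_base\<close>)
  then show ?thesis using eq_card_imp_inj_on[OF assms(1) c(1)] by (simp add: row_independent_def)
qed

lemma gain_sparse_iff_sparse:
  assumes "fin_digraph H"
  shows "gain_sparse 2 3 2 H \<psi> \<longleftrightarrow> sparse (tail H) (head H) \<psi> (arcs H)"
proof -
  interpret fin_digraph H by (rule assms)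
  have bal: "balanced H \<psi> F \<longleftrightarrow> (\<exists>\<sigma>. potential (tail H) (head H) \<psi> F \<sigma>)" if "F \<subseteq> arcs H" for F
    using potential_if_balanced[OF wf_digraph finite_subset[OF that finite_arcs] that]
      balanced_if_potential by blast
  have bal': "F \<subseteq> arcs H \<and> F \<noteq> {} \<and> balanced H \<psi> F \<longleftrightarrow>
      F \<subseteq> arcs H \<and> F \<noteq> {} \<and> (\<exists>\<sigma>. potential (tail H) (head H) \<psi> F \<sigma>)" for F
    using bal[of F] by blast
  have nat_int: "int a \<le> int 2 * int b - int k \<longleftrightarrow> a + k \<le> 2 * b" for a b k by linarith
  show ?thesis
    unfolding gain_sparse_def sparse_def endpoints_def nat_int bal' by blast
qed

theorem theorem6p8:
  fixes H :: "('v::finite, 'e) pre_digraph"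
    and \<psi> :: "'e \<Rightarrow> bit"
    and \<tau> :: "bit \<Rightarrow> real^2^2"
    and p :: "'v \<Rightarrow> real^2"
  assumes "faithful_representation \<tau> half_turn_group"
    and "fin_digraph H"
    and "symmetric_regular H \<tau> \<psi> p"
  shows "row_independent (arcs H) (orbit_matrix_row H \<tau> \<psi> p) \<longleftrightarrow> gain_sparse 2 3 2 H \<psi>"
proof -
  let ?s = "symmetric_row (tail H) (head H) \<psi>" and ?a = "edge_row (tail H) (head H) \<psi>"
  let ?p = "vec_lambda p :: real^2^'v"
  have fin: "finite (arcs H)" using assms(2) by (rule fin_digraph.finite_arcs)
  have row: "orbit_matrix_row H \<tau> \<psi> p = ?a ?p"
    by (rule ext) (simp add: orbit_matrix_row_eq[OF assms(1)])
  have "row_independent (arcs H) (?a ?p)" if sparse: "sparse (tail H) (head H) \<psi> (arcs H)"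
  proof -
    obtain q where q: "row_independent (arcs H) (?a q)" using sparse_realizable[OF fin sparse] by blast
    \<comment> \<open>\<open>q\<close> may have a small symmetric rank, so the symmetric rank at
      \<open>p\<close> is recorded by a basis \<open>B\<close> to be preserved.\<close>
    obtain B where B: "B \<subseteq> arcs H" "row_independent B (?s ?p)" "card B = dim (?s ?p ` arcs H)"
      using row_independent_basis[of "arcs H" "?s ?p"] by blast
    have "finite B" using finite_subset[OF B(1) fin] .
    from common_row_independent_parameter[OF this fin linear_symmetric_row linear_edge_row B(2) q]
    obtain x where x: "row_independent B (?s x)" "row_independent (arcs H) (?a x)" by blast
    \<comment> \<open>At \<open>x\<close> the symmetric rank is at least that at \<open>p\<close>
      and the orbit rank is full. As the sum of both ranks is maximal at \<open>p\<close>, the orbit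
      rank at \<open>p\<close> must be full too.\<close>
    have "rigidity_rank (covering_edges H \<psi>) (symmetric_lift \<tau> (($) x))
        \<le> rigidity_rank (covering_edges H \<psi>) (symmetric_lift \<tau> p)"
      using assms(3) by (simp add: symmetric_regular_def)
    then have "dim (?s x ` arcs H) + dim (?a x ` arcs H) \<le> dim (?s ?p ` arcs H) + dim (?a ?p ` arcs H)"
      by (simp add: rigidity_rank_covering[OF assms(1)])
    moreover have "card B \<le> dim (?s x ` arcs H)" "card (arcs H) \<le> dim (?a x ` arcs H)"
      using row_independent_card_le_dim x B(1) by blast+
    ultimately show ?thesis using B(3) fin by (intro row_independent_if_card_le_dim) linarith+
  qed
  moreover have "sparse (tail H) (head H) \<psi> (arcs H)" if "row_independent (arcs H) (?a ?p)"
    by (rule sparse_if_row_independent[OF fin that])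
  ultimately show ?thesis
    unfolding row gain_sparse_iff_sparse[OF assms(2)] by blast
qed

end
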